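(* For every $n\ge 2$, the structure group of the theory $C_n$ of $n$-Catalan algebras is isomorphic to the higher Thompson group $F_{n,1}$: $\mathrm{Struct}_G(C_n)\cong F_{n,1}$.
   Context: Composition: $f\cdot g$ means "$f$ followed by $g$". For integers $i\le j$, $x_i^j$ denotes the list $x_i,x_{i+1},\dots,x_j$; if $i>j$ it is the empty list. **Theory $C_n$.** $\mathcal{V}$ is a set of variables, there is a single $n$-ary function symbol $\otimes$, and $\mathbb{F}_\otimes(\mathcal{V})$ is the absolutely free term algebra. The equations of $C_n$ are, for $0<i<n$, $$\otimes(x_1^i,\otimes(x_{i+1}^{i+n}),x_{i+n+1}^{2n-1})=\otimes(x_1^{i-1},\otimes(x_i^{i+n-1}),x_{i+n}^{2n-1}).$$ **Structure group.** A substitution is a map $\varphi:\mathcal{V}\to\mathbb{F}_\otimes(\mathcal{V})$, extended to an endomorphism $s\mapsto s^\varphi$ of the term algebra. For an equation $s=t$ or its reverse, $\rho_{s,t}$ is the partial function on $\mathbb{F}_\otimes(\mathcal{V})$ with graph $\{(s^\varphi,t^\varphi)\mid\varphi\text{ a substitution}\}$. An address is a word $\alpha$ in $\{1,\dots,n\}$, specifying the path from the root of a term tree to a subterm; $\rho_{s,t}^\alpha$ is the partial function defined on terms $u$ that have a subterm at $\alpha$ lying in the domain of $\rho_{s,t}$, and it replaces that subterm by its image under $\rho_{s,t}$, leaving the rest of $u$ unchanged. $\mathrm{Struct}(C_n)$ is the monoid of partial maps generated under composition by all $\rho_{s,t}^\alpha$ with $(s,t)$ or $(t,s)$ an equation of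 $C_n$ and $\alpha$ an address; it is an inverse monoid. $\mathrm{Struct}_G(C_n)$ is its universal group, obtained by collapsing all idempotents to $1$. **The group $F_{n,1}$.** An $n$-ary tree is either a single vertex or a root with an ordered list of $n$ subtrees that are $n$-ary trees; $\ell(T)$ is the set of leaves of $T$. A simple expansion of a tree replaces one leaf $v$ by a vertex with $n$ ordered leaf children $\alpha_1(v),\dots,\alpha_n(v)$. An $n$-ary tree diagram is a triple $(T_1,T_2,\sigma)$ with $T_1,T_2$ $n$-ary trees with the same number of leaves and $\sigma:\ell(T_1)\to\ell(T_2)$ a bijection. A simple expansion of $(T_1,T_2,\sigma)$ is $(T_1',T_2',\sigma')$ where $T_1'$ is the simple expansion of $T_1$ at a leaf $l$, $T_2'$ is the simple expansion of $T_2$ at $\sigma(l)$, $\sigma'=\sigma$ on $\ell(T_1)\setminus\{l\}$ and $\sigma'(\alpha_i(l))=\alpha_i(\sigma(l))$. An expansion is the result of finitely many successive simple expansions. Two tree diagrams are equivalent if they have a common expansion; the equivalence class $[(T_1,T_2,\sigma)]$ is an $n$-ary tree symbol. $G_{n,1}$ is the group of $n$-ary tree symbols with product $[(T_1,T,\sigma)][(T,T_2,\sigma')]=[(T_1,T_2,\sigma\cdot\sigma')]$ (representatives can always be chosen with matching middle tree), inverse $[(T_1,T_2,\sigma)]^{-1}=[(T_2,T_1,\sigma^{-1})]$ and unit $[(T,T,\mathrm{id})]$. The leaves of a tree are ordered left to right (lexicographically by their addresses as words in $\{1,\dots,n\}$). $F_{n,1}$ is the subgroup of $G_{n,1}$ of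 symbols $[(T_1,T_2,\sigma)]$ with $\sigma$ order-preserving. *)

theory Defs
  imports "HOL-Algebra.Group"
begin

section \<open>Terms over a single \<open>n\<close>-ary symbol\<close>

datatype 'v trm = Var 'v | Op "'v trm list"

inductive_set terms :: "nat \<Rightarrow> 'v trm set" for n :: nat where
  Var: "Var v \<in> terms n"
| Op: "length ts = n \<Longrightarrow> \<forall>t\<in>set ts. t \<in> terms n \<Longrightarrow> Op ts \<in> terms n"

primrec subst :: "('v \<Rightarrow> 'v trm) \<Rightarrow> 'v trm \<Rightarrow> 'v trm" where
  "subst \<phi> (Var v) = \<phi> v"
| "subst \<phi> (Op ts) = Op (map (subst \<phi>) ts)"

text \<open>\<open>vars x i j\<close> is the list \<open>x\<^sub>i, \<dots>, x\<^sub>j\<close>, empty if \<open>i > j\<close>.\<close>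

definition vars :: "(nat \<Rightarrow> 'v) \<Rightarrow> nat \<Rightarrow> nat \<Rightarrow> 'v trm list" where
  "vars x i j = map (\<lambda>k. Var (x k)) [i..<Suc j]"

definition catalan_eqs :: "nat \<Rightarrow> (nat \<Rightarrow> 'v) \<Rightarrow> ('v trm \<times> 'v trm) set" where
  "catalan_eqs n x =
     {(Op (vars x 1 i @ [Op (vars x (i + 1) (i + n))] @ vars x (i + n + 1) (2 * n - 1)),
       Op (vars x 1 (i - 1) @ [Op (vars x i (i + n - 1))] @ vars x (i + n) (2 * n - 1))) | i.
      0 < i \<and> i < n}"


section \<open>The structure monoid and the structure group\<close>

text \<open>Partial functions on terms are represented by their graphs; relational composition
  \<open>f O g\<close> is \<open>f\<close> followed by \<open>g\<close>. Addresses are words in \<open>{1..n}\<close>, hence the index shift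
  when descending into an argument list.\<close>

definition rho :: "nat \<Rightarrow> 'v trm \<Rightarrow> 'v trm \<Rightarrow> ('v trm \<times> 'v trm) set" where
  "rho n s t = {(subst \<phi> s, subst \<phi> t) | \<phi>. range \<phi> \<subseteq> terms n}"

fun subterm_at :: "'v trm \<Rightarrow> nat list \<Rightarrow> 'v trm option" where
  "subterm_at t [] = Some t"
| "subterm_at (Var v) (k # \<alpha>) = None"
| "subterm_at (Op ts) (k # \<alpha>) =
     (if 1 \<le> k \<and> k \<le> length ts then subterm_at (ts ! (k - 1)) \<alpha> else None)"

fun replace_at :: "'v trm \<Rightarrow> nat list \<Rightarrow> 'v trm \<Rightarrow> 'v trm" where
  "replace_at t [] u = u"
| "replace_at (Var v) (k # \<alpha>) u = Var v"
| "replace_at (Op ts) (k # \<alpha>) u = Op (ts[k - 1 := replace_at (ts ! (k - 1)) \<alpha> u])"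

definition rho_at :: "nat \<Rightarrow> nat list \<Rightarrow> 'v trm \<Rightarrow> 'v trm \<Rightarrow> ('v trm \<times> 'v trm) set" where
  "rho_at n \<alpha> s t =
     {(u, replace_at u \<alpha> w') | u w w'.
      u \<in> terms n \<and> subterm_at u \<alpha> = Some w \<and> (w, w') \<in> rho n s t}"

inductive_set struct_carrier :: "nat \<Rightarrow> (nat \<Rightarrow> 'v) \<Rightarrow> ('v trm \<times> 'v trm) set set"
  for n :: nat and x :: "nat \<Rightarrow> 'v" where
  one: "Id_on (terms n) \<in> struct_carrier n x"
| gen: "(s, t) \<in> catalan_eqs n x \<or> (t, s) \<in> catalan_eqs n x \<Longrightarrow> set \<alpha> \<subseteq> {1..n} \<Longrightarrow>
        rho_at n \<alpha> s t \<in> struct_carrier n x"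
| comp: "f \<in> struct_carrier n x \<Longrightarrow> g \<in> struct_carrier n x \<Longrightarrow> f O g \<in> struct_carrier n x"

definition struct_monoid :: "nat \<Rightarrow> (nat \<Rightarrow> 'v) \<Rightarrow> ('v trm \<times> 'v trm) set monoid" where
  "struct_monoid n x =
     \<lparr>carrier = struct_carrier n x, mult = (O), one = Id_on (terms n)\<rparr>"

text \<open>The least congruence of a monoid that identifies every idempotent with the unit.\<close>

inductive_set idem_cong :: "('a, 'b) monoid_scheme \<Rightarrow> ('a \<times> 'a) set" for M (structure) where
  idem: "e \<in> carrier M \<Longrightarrow> e \<otimes> e = e \<Longrightarrow> (e, \<one>) \<in> idem_cong M"
| refl: "a \<in> carrier M \<Longrightarrow> (a, a) \<in> idem_cong M"
| sym: "(a, b) \<in> idem_cong M \<Longrightarrow> (b, a) \<in> idem_cong M"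
| trans: "(a, b) \<in> idem_cong M \<Longrightarrow> (b, c) \<in> idem_cong M \<Longrightarrow> (a, c) \<in> idem_cong M"
| mult: "(a, b) \<in> idem_cong M \<Longrightarrow> (c, d) \<in> idem_cong M \<Longrightarrow> (a \<otimes> c, b \<otimes> d) \<in> idem_cong M"

definition universal_group :: "('a, 'b) monoid_scheme \<Rightarrow> 'a set monoid" where
  "universal_group M =
     \<lparr>carrier = carrier M // idem_cong M,
      mult = (\<lambda>A B. \<Union>a\<in>A. \<Union>b\<in>B. idem_cong M `` {a \<otimes>\<^bsub>M\<^esub> b}),
      one = idem_cong M `` {\<one>\<^bsub>M\<^esub>}\<rparr>"

definition struct_group :: "nat \<Rightarrow> (nat \<Rightarrow> 'v) \<Rightarrow> ('v trm \<times> 'v trm) set set monoid" where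
  "struct_group n x = universal_group (struct_monoid n x)"


section \<open>Tree diagrams and the group \<open>F\<^sub>n\<^sub>,\<^sub>1\<close>\<close>

datatype tree = Leaf | Node "tree list"

inductive_set trees :: "nat \<Rightarrow> tree set" for n :: nat where
  Leaf: "Leaf \<in> trees n"
| Node: "length ts = n \<Longrightarrow> \<forall>t\<in>set ts. t \<in> trees n \<Longrightarrow> Node ts \<in> trees n"

text \<open>Leaves are identified with their addresses; the \<open>i\<close>-th child of a vertex \<open>v\<close>
  is \<open>v @ [i]\<close>.\<close>

primrec leaves :: "tree \<Rightarrow> nat list set" where
  "leaves Leaf = {[]}"
| "leaves (Node ts) = (\<Union>k\<in>{1..length ts}. (#) k ` (map leaves ts ! (k - 1)))"

text \<open>\<open>expand n T l\<close> is the simple expansion of \<open>T\<close> at \<open>l\<close>; it is only meaningful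
  for \<open>l \<in> leaves T\<close>.\<close>

fun expand :: "nat \<Rightarrow> tree \<Rightarrow> nat list \<Rightarrow> tree" where
  "expand n Leaf l = Node (replicate n Leaf)"
| "expand n (Node ts) [] = Node ts"
| "expand n (Node ts) (k # l) = Node (ts[k - 1 := expand n (ts ! (k - 1)) l])"

type_synonym diagram = "tree \<times> tree \<times> (nat list \<Rightarrow> nat list)"

text \<open>The leaf bijection is kept undefined outside \<open>leaves T\<^sub>1\<close>, so that diagrams with the
  same graph are equal.\<close>

definition diagrams :: "nat \<Rightarrow> diagram set" where
  "diagrams n = {(T\<^sub>1, T\<^sub>2, \<sigma>). T\<^sub>1 \<in> trees n \<and> T\<^sub>2 \<in> trees n \<and>
     \<sigma> \<in> extensional (leaves T\<^sub>1) \<and> bij_betw \<sigma> (leaves T\<^sub>1) (leaves T\<^sub>2)}"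

inductive_set simple_expansion :: "nat \<Rightarrow> (diagram \<times> diagram) set" for n :: nat where
  "(T\<^sub>1, T\<^sub>2, \<sigma>) \<in> diagrams n \<Longrightarrow> l \<in> leaves T\<^sub>1 \<Longrightarrow>
   (expand n T\<^sub>1 l, expand n T\<^sub>2 (\<sigma> l), \<sigma>') \<in> diagrams n \<Longrightarrow>
   \<forall>m\<in>leaves T\<^sub>1 - {l}. \<sigma>' m = \<sigma> m \<Longrightarrow>
   \<forall>i\<in>{1..n}. \<sigma>' (l @ [i]) = \<sigma> l @ [i] \<Longrightarrow>
   ((T\<^sub>1, T\<^sub>2, \<sigma>), (expand n T\<^sub>1 l, expand n T\<^sub>2 (\<sigma> l), \<sigma>')) \<in> simple_expansion n"

definition diagram_equiv :: "nat \<Rightarrow> (diagram \<times> diagram) set" where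
  "diagram_equiv n = {(d, d'). d \<in> diagrams n \<and> d' \<in> diagrams n \<and>
     (\<exists>e. (d, e) \<in> (simple_expansion n)\<^sup>* \<and> (d', e) \<in> (simple_expansion n)\<^sup>*)}"

text \<open>The classes in the union below are all equal: the product does not depend on the
  representatives with matching middle tree. Since \<open>\<sigma> \<cdot> \<sigma>'\<close> is \<open>\<sigma>\<close> followed by \<open>\<sigma>'\<close>, it is
  \<open>compose (leaves T\<^sub>1) \<sigma>' \<sigma>\<close>.\<close>

definition G_group :: "nat \<Rightarrow> diagram set monoid" where
  "G_group n =
     \<lparr>carrier = diagrams n // diagram_equiv n,
      mult = (\<lambda>A B. \<Union>{diagram_equiv n `` {(T\<^sub>1, T\<^sub>2, compose (leaves T\<^sub>1) \<sigma>' \<sigma>)} | T\<^sub>1 T T\<^sub>2 \<sigma> \<sigma>'.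
                       (T\<^sub>1, T, \<sigma>) \<in> A \<and> (T, T\<^sub>2, \<sigma>') \<in> B}),
      one = diagram_equiv n `` {(Leaf, Leaf, restrict id (leaves Leaf))}\<rparr>"

definition order_preserving :: "diagram \<Rightarrow> bool" where
  "order_preserving = (\<lambda>(T\<^sub>1, T\<^sub>2, \<sigma>). \<forall>l\<in>leaves T\<^sub>1. \<forall>m\<in>leaves T\<^sub>1.
     (l, m) \<in> lexord less_than \<longrightarrow> (\<sigma> l, \<sigma> m) \<in> lexord less_than)"

definition F_group :: "nat \<Rightarrow> diagram set monoid" where
  "F_group n = (G_group n)\<lparr>carrier := {A \<in> carrier (G_group n). \<exists>d\<in>A. order_preserving d}\<rparr>"

end

theory Submission imports Defs "HOL-Library.Stream" "HOL-Library.List_Lexorder" begin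

text \<open>
  A tree diagram acts on infinite words over \<open>{1..n}\<close> by replacing a prefix \<open>l\<close>, a leaf of the
  first tree, with \<open>\<sigma> l\<close>. Two diagrams are equivalent iff they act in the same way, because both
  expand to diagrams whose first tree is the full tree of some common depth. Likewise every pair
  \<open>(u, v)\<close> of terms with the same sequence of labels acts, through the order-preserving diagram of
  its shapes, and all pairs in the graph of an element of the structure monoid act in the same way.
  This gives a homomorphism from the structure monoid to \<open>F\<^sub>n\<^sub>,\<^sub>1\<close>. An element acts trivially iff
  it is idempotent, so the fibres of the homomorphism are exactly the classes of the universal
  group. It is surjective since every term can be rewritten to a right comb, which is determined by
  its sequence of labels. Finally, elements of the monoid are defined on all sufficiently deep
  terms, so none of them is empty; an empty element would be a zero and would make the universal
  group trivial.
\<close>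

(* otherwise the simplifier turns {1..n} into {Suc 0..n} *)
declare One_nat_def [simp del]

section \<open>Leaves and expansions of trees\<close>

text \<open>Equivalence of diagrams asks for a common expansion, so transitivity and independence of
  representatives would call for a confluence argument. Passing to maps on infinite words removes
  it: a class becomes the set of all diagrams with a given action, and products become composition
  of maps. The condition \<open>n \<ge> 2\<close> makes this faithful, since over one letter every
  prefix replacement fixes the only infinite word. Injectivity of \<open>x\<close> on
  \<open>{1..2 * n - 1}\<close> makes the variables of an equation distinct, so that a generator
  applies to arguments chosen freely. Every element then has a nonempty graph and, as the leaves of
  a tree cover all infinite words, a single pair of the graph determines the action. Elements with
  equal action differ only in their domains, and this difference is exactly what collapsing the
  idempotents forgets.\<close>

lemma Node_leaves_iff [simp]:
  "k # l \<in> leaves (Node ts) \<longleftrightarrow> 1 \<le> k \<and> k \<le> length ts \<and> l \<in> leaves (ts ! (k - 1))"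
  by (auto simp: image_iff)

lemma Nil_notin_leaves_Node [simp]: "[] \<notin> leaves (Node ts)"
  by auto

lemma leaves_NodeE:
  assumes "l \<in> leaves (Node ts)"
  obtains k l' where "l = k # l'" "1 \<le> k" "k \<le> length ts" "l' \<in> leaves (ts ! (k - 1))"
  using assms by (cases l) (auto simp del: leaves.simps)

declare leaves.simps(2) [simp del]

lemma Nil_in_leaves_iff: "[] \<in> leaves T \<longleftrightarrow> T = Leaf"
  by (cases T) auto

lemma finite_leaves: "finite (leaves T)"
proof (induction T)
  case (Node ts)
  have "leaves (Node ts) \<subseteq> (\<Union>k\<in>{1..length ts}. (#) k ` leaves (ts ! (k - 1)))"
    by (auto elim!: leaves_NodeE simp: image_iff)
  moreover have "finite (\<Union>k\<in>{1..length ts}. (#) k ` leaves (ts ! (k - 1)))"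
  proof (intro finite_UN_I finite_imageI)
    fix k assume "k \<in> {1..length ts}"
    then have "ts ! (k - 1) \<in> set ts" by auto
    then show "finite (leaves (ts ! (k - 1)))" by (rule Node)
  qed simp
  ultimately show ?case
    by (rule finite_subset)
qed simp

lemma leaves_in_lists: "T \<in> trees n \<Longrightarrow> l \<in> leaves T \<Longrightarrow> l \<in> lists {1..n}"
proof (induction T arbitrary: l rule: trees.induct)
  case (Node ts)
  obtain k l' where l: "l = k # l'" "1 \<le> k" "k \<le> length ts" "l' \<in> leaves (ts ! (k - 1))"
    using Node.prems by (rule leaves_NodeE)
  then have "ts ! (k - 1) \<in> set ts" by auto
  then have "l' \<in> lists {1..n}"
    using Node.IH l by blast
  then show ?case
    using l Node.hyps by simp
qed simp

text \<open>Distinct leaves branch off at different children of a common vertex, where their words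
  differ. Stating prefix-freeness through streams gives the form that makes prefix replacement a
  well-defined map.\<close>

lemma leaves_antichain:
  assumes "l \<in> leaves T" "m \<in> leaves T" "l @- w = m @- w'"
  shows "l = m"
  using assms
proof (induction T arbitrary: l m)
  case (Node ts)
  obtain k l' where l: "l = k # l'" "1 \<le> k" "k \<le> length ts" "l' \<in> leaves (ts ! (k - 1))"
    using Node.prems(1) by (rule leaves_NodeE)
  obtain k' m' where m: "m = k' # m'" "m' \<in> leaves (ts ! (k' - 1))"
    using Node.prems(2) by (rule leaves_NodeE)
  have "k' = k" "l' @- w = m' @- w'"
    using l(1) m(1) Node.prems(3) by simp_all
  moreover have "ts ! (k - 1) \<in> set ts"
    using l by auto
  ultimately show ?case
    using Node.IH[of "ts ! (k - 1)" l' m'] l m by auto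
qed simp

text \<open>Descending along the word ends at a leaf because the tree is finite. Together with
  \<open>leaves_antichain\<close>, every infinite word passes through exactly one leaf.\<close>

lemma leaves_cover:
  assumes "T \<in> trees n" "w \<in> streams {1..n}"
  obtains l w' where "l \<in> leaves T" "w' \<in> streams {1..n}" "w = l @- w'"
proof -
  have "\<exists>l\<in>leaves T. \<exists>w'\<in>streams {1..n}. w = l @- w'"
    using assms
  proof (induction T arbitrary: w rule: trees.induct)
    case Leaf
    then show ?case by auto
  next
    case (Node ts)
    obtain k v where w: "w = k ## v" "k \<in> {1..n}" "v \<in> streams {1..n}"
      using Node.prems by (cases w) (auto simp: streams_Stream)
    moreover have "ts ! (k - 1) \<in> set ts"
      using w Node.hyps by auto
    ultimately obtain l w' where "l \<in> leaves (ts ! (k - 1))" "w' \<in> streams {1..n}" "v = l @- w'"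
      using Node by blast
    then show ?case
      using w Node.hyps by (intro bexI[of _ "k # l"] bexI[of _ w']) auto
  qed
  then show thesis using that by blast
qed

lemma shift_in_streams: "T \<in> trees n \<Longrightarrow> l \<in> leaves T \<Longrightarrow> w \<in> streams {1..n} \<Longrightarrow> l @- w \<in> streams {1..n}"
  by (auto intro!: shift_streams dest: leaves_in_lists)

text \<open>The words starting with \<open>k\<close> give the leaves of the \<open>k\<close>-th
  child. This recovers the second tree of a diagram from the image of its bijection.\<close>

lemma leaves_inject:
  "T \<in> trees n \<Longrightarrow> T' \<in> trees n \<Longrightarrow> leaves T = leaves T' \<Longrightarrow> T = T'"
proof (induction T arbitrary: T' rule: trees.induct)
  case Leaf
  then show ?case
    using Nil_in_leaves_iff[of T'] by force
next
  case (Node ts)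
  obtain ts' where T': "T' = Node ts'"
    by (metis Node.prems(2) Nil_in_leaves_iff tree.distinct(1) tree.exhaust)
  then have ts': "length ts' = n" "\<forall>t\<in>set ts'. t \<in> trees n"
    using Node.prems(1) by (auto elim: trees.cases)
  have "ts ! i = ts' ! i" if i: "i < n" for i
  proof -
    have "l \<in> leaves (ts ! i) \<longleftrightarrow> l \<in> leaves (ts' ! i)" for l
      using Node_leaves_iff[of "Suc i" l ts] Node_leaves_iff[of "Suc i" l ts'] i ts' Node.hyps
        Node.prems(2)[unfolded T'] by simp
    moreover have "ts ! i \<in> set ts" "ts' ! i \<in> set ts'"
      using i ts' Node.hyps by auto
    ultimately show ?thesis
      using Node.IH ts' by blast
  qed
  then show ?case
    using T' ts' Node.hyps by (auto intro: nth_equalityI)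
qed

lemma expand_in_trees:
  "T \<in> trees n \<Longrightarrow> l \<in> leaves T \<Longrightarrow> expand n T l \<in> trees n"
proof (induction T arbitrary: l rule: trees.induct)
  case Leaf
  then show ?case by (auto intro!: trees.intros)
next
  case (Node ts)
  obtain k l' where l: "l = k # l'" "1 \<le> k" "k \<le> length ts" "l' \<in> leaves (ts ! (k - 1))"
    using Node.prems by (rule leaves_NodeE)
  then have "ts ! (k - 1) \<in> set ts" by auto
  then have "expand n (ts ! (k - 1)) l' \<in> trees n"
    using Node.IH l by blast
  then show ?case
    using l Node by (auto intro!: trees.Node dest: set_update_subset_insert[THEN subsetD])
qed

lemma leaves_expand:
  "T \<in> trees n \<Longrightarrow> l \<in> leaves T \<Longrightarrow>
     leaves (expand n T l) = leaves T - {l} \<union> (\<lambda>i. l @ [i]) ` {1..n}"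
proof (induction T arbitrary: l rule: trees.induct)
  case Leaf
  then show ?case
    by (auto elim!: leaves_NodeE)
next
  case (Node ts)
  obtain k l' where l: "l = k # l'" "1 \<le> k" "k \<le> length ts" "l' \<in> leaves (ts ! (k - 1))"
    using Node.prems by (rule leaves_NodeE)
  then have "ts ! (k - 1) \<in> set ts" by auto
  then have IH: "leaves (expand n (ts ! (k - 1)) l') =
      leaves (ts ! (k - 1)) - {l'} \<union> (\<lambda>i. l' @ [i]) ` {1..n}"
    using Node.IH l by blast
  have "m \<in> leaves (expand n (Node ts) l) \<longleftrightarrow>
    m \<in> leaves (Node ts) - {l} \<union> (\<lambda>i. l @ [i]) ` {1..n}" for m
  proof (cases m)
    case (Cons j m')
    then show ?thesis
      using l(2,3) unfolding l(1) Cons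
      by (cases "j = k") (auto simp: IH image_iff nth_list_update)
  qed (use l in auto)
  then show ?case by blast
qed

text \<open>Pad a word of length \<open>N\<close> with the letter 1 to an infinite word: the leaf on
  its path has length \<open>N\<close> and is therefore the word itself. So the tree is the full one
  of depth \<open>N\<close>.\<close>

lemma leaves_uniform:
  assumes "T \<in> trees n" "1 \<le> n" "\<forall>l\<in>leaves T. length l = N"
  shows "leaves T = {l \<in> lists {1..n}. length l = N}"
proof (intro subset_antisym subsetI)
  fix l assume l: "l \<in> {l \<in> lists {1..n}. length l = N}"
  have "l @- sconst 1 \<in> streams {1..n}"
    using l assms(2) by (intro shift_streams) (auto simp: streams_iff_sset)
  from leaves_cover[OF assms(1) this] obtain m w where m: "m \<in> leaves T" "l @- sconst 1 = m @- w"
    by blast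
  moreover have "stake N (l @- sconst 1) = l" "stake N (m @- w) = m"
    using l m(1) assms(3) by (auto simp: stake_shift)
  ultimately show "l \<in> leaves T"
    by metis
next
  fix l assume "l \<in> leaves T"
  then show "l \<in> {l \<in> lists {1..n}. length l = N}"
    using leaves_in_lists[OF assms(1)] assms(3) by blast
qed

section \<open>The action of tree diagrams on infinite words\<close>

text \<open>A relation rather than a function of the diagram: the values of \<open>F\<close> outside
  \<open>streams {1..n}\<close> stay free, and a product acts by the plain composite of two such
  maps.\<close>

definition dacts :: "nat \<Rightarrow> (nat stream \<Rightarrow> nat stream) \<Rightarrow> diagram \<Rightarrow> bool" where
  "dacts n F = (\<lambda>(T\<^sub>1, T\<^sub>2, \<sigma>). \<forall>l\<in>leaves T\<^sub>1. \<forall>w\<in>streams {1..n}. F (l @- w) = \<sigma> l @- w)"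

lemma dactsD:
  "dacts n F (T\<^sub>1, T\<^sub>2, \<sigma>) \<Longrightarrow> l \<in> leaves T\<^sub>1 \<Longrightarrow> w \<in> streams {1..n} \<Longrightarrow>
    F (l @- w) = \<sigma> l @- w"
  unfolding dacts_def prod.case by blast

lemma dacts_exists:
  assumes "d \<in> diagrams n"
  shows "\<exists>F. dacts n F d"
proof -
  obtain T\<^sub>1 T\<^sub>2 \<sigma> where d: "d = (T\<^sub>1, T\<^sub>2, \<sigma>)"
    by (cases d)
  \<comment> \<open>By \<open>leaves_antichain\<close> a word splits at a leaf in only one way, so
    the choice is forced.\<close>
  define F where
    "F w = (let (l, w') = (SOME (l, w'). l \<in> leaves T\<^sub>1 \<and> w = l @- w') in \<sigma> l @- w')" for w
  have "F (l @- w) = \<sigma> l @- w" if "l \<in> leaves T\<^sub>1" for l w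
  proof -
    have "(SOME (m, w'). m \<in> leaves T\<^sub>1 \<and> l @- w = m @- w') = (l, w)"
    proof (rule some_equality)
      fix p assume "case p of (m, w') \<Rightarrow> m \<in> leaves T\<^sub>1 \<and> l @- w = m @- w'"
      then obtain m w' where p: "p = (m, w')" "m \<in> leaves T\<^sub>1" "l @- w = m @- w'"
        by blast
      moreover have "l = m"
        using that p(2,3) by (rule leaves_antichain)
      ultimately show "p = (l, w)"
        by simp
    qed (use that in simp)
    then show ?thesis
      by (simp add: F_def)
  qed
  then show ?thesis
    unfolding dacts_def d by blast
qed

lemma dacts_cong: "(\<And>w. w \<in> streams {1..n} \<Longrightarrow> F w = G w) \<Longrightarrow> d \<in> diagrams n \<Longrightarrow>
    dacts n F d \<longleftrightarrow> dacts n G d"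
  unfolding dacts_def diagrams_def using shift_in_streams by fastforce

lemma dacts_unique:
  assumes "d \<in> diagrams n" "dacts n F d" "dacts n G d" "w \<in> streams {1..n}"
  shows "F w = G w"
proof -
  obtain T\<^sub>1 T\<^sub>2 \<sigma> where d: "d = (T\<^sub>1, T\<^sub>2, \<sigma>)"
    by (cases d)
  have "T\<^sub>1 \<in> trees n"
    using assms(1) by (simp add: d diagrams_def)
  then obtain l w' where "l \<in> leaves T\<^sub>1" "w' \<in> streams {1..n}" "w = l @- w'"
    using \<open>w \<in> streams {1..n}\<close> by (rule leaves_cover)
  then show ?thesis
    using dactsD assms(2,3) unfolding d by metis
qed

lemma dacts_maps:
  assumes "d \<in> diagrams n" "dacts n F d" "w \<in> streams {1..n}"
  shows "F w \<in> streams {1..n}"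
proof -
  obtain T\<^sub>1 T\<^sub>2 \<sigma> where d: "d = (T\<^sub>1, T\<^sub>2, \<sigma>)"
    by (cases d)
  have "T\<^sub>1 \<in> trees n"
    using assms(1) by (simp add: d diagrams_def)
  then obtain l w' where lw: "l \<in> leaves T\<^sub>1" "w' \<in> streams {1..n}" "w = l @- w'"
    using \<open>w \<in> streams {1..n}\<close> by (rule leaves_cover)
  have "T\<^sub>2 \<in> trees n" "bij_betw \<sigma> (leaves T\<^sub>1) (leaves T\<^sub>2)"
    using assms(1) by (simp_all add: d diagrams_def)
  then have "T\<^sub>2 \<in> trees n" "\<sigma> l \<in> leaves T\<^sub>2"
    using lw(1) bij_betw_apply by fast+
  then have "\<sigma> l @- w' \<in> streams {1..n}"
    using lw(2) by (rule shift_in_streams)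
  moreover have "F w = \<sigma> l @- w'"
    using dactsD[OF assms(2)[unfolded d] lw(1,2)] lw(3) by simp
  ultimately show ?thesis
    by simp
qed

text \<open>The leaf of the second tree on the path of \<open>w\<close> is pulled back through the
  bijection. Surjectivity is what later forces idempotents to act trivially.\<close>

lemma dacts_surj:
  assumes "d \<in> diagrams n" "dacts n F d" "w \<in> streams {1..n}"
  obtains v where "v \<in> streams {1..n}" "F v = w"
proof -
  obtain T\<^sub>1 T\<^sub>2 \<sigma> where d: "d = (T\<^sub>1, T\<^sub>2, \<sigma>)"
    by (cases d)
  have "T\<^sub>2 \<in> trees n"
    using assms(1) by (simp add: d diagrams_def)
  then obtain m w' where m: "m \<in> leaves T\<^sub>2" "w' \<in> streams {1..n}" "w = m @- w'"
    using \<open>w \<in> streams {1..n}\<close> by (rule leaves_cover)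
  have "\<sigma> ` leaves T\<^sub>1 = leaves T\<^sub>2"
    using assms(1) by (simp add: d diagrams_def bij_betw_def)
  then obtain l where l: "l \<in> leaves T\<^sub>1" "\<sigma> l = m"
    using m(1) by (metis imageE)
  show thesis
  proof (rule that)
    show "l @- w' \<in> streams {1..n}"
      using assms(1) by (intro shift_in_streams[OF _ l(1) m(2)]) (simp add: d diagrams_def)
    show "F (l @- w') = w"
      using dactsD[OF assms(2)[unfolded d] l(1) m(2)] l(2) m(3) by simp
  qed
qed

text \<open>If \<open>m\<close> were longer than \<open>l\<close>, the continuations by constant 1
  and by constant 2 would prescribe different letters for \<open>m\<close> just after the prefix
  \<open>l\<close>. This is faithfulness of the action, and it needs two letters.\<close>

lemma shift_eq_imp_eq:
  assumes "n \<ge> 2" "\<And>w. w \<in> streams {1..n} \<Longrightarrow> l @- w = m @- w"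
  shows "(l :: nat list) = m"
proof -
  have c: "sconst 1 \<in> streams {1..n}" "sconst 2 \<in> streams {1..n}"
    using assms(1) by (auto simp: streams_iff_sset)
  have "l = m" if "length l \<le> length m" "\<And>w. w \<in> streams {1..n} \<Longrightarrow> l @- w = m @- w" for l m
  proof -
    let ?j = "length m"
    have "stake ?j (l @- sconst 1) = m" "stake ?j (l @- sconst 2) = m"
      using that(2)[OF c(1)] that(2)[OF c(2)] by (simp_all add: stake_shift)
    then have "l @ stake (?j - length l) (sconst 1) = m" "l @ stake (?j - length l) (sconst 2) = m"
      using that(1) by (simp_all add: stake_shift)
    then have "stake (?j - length l) (sconst 1) = stake (?j - length l) (sconst (2::nat))"
      by (metis same_append_eq)
    then have "hd (stake (?j - length l) (sconst 1)) = hd (stake (?j - length l) (sconst (2::nat)))"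
      by (rule arg_cong)
    then have "?j - length l = 0"
      by (cases "?j - length l") (simp_all del: stake_siterate)
    with \<open>l @ stake (?j - length l) (sconst 1) = m\<close> show ?thesis
      by auto
  qed
  then show ?thesis
    using assms(2) by (metis nat_le_linear)
qed

text \<open>Every word begins with one of the \<open>n\<close> letters, so the condition at
  \<open>l\<close> is the conjunction of the conditions at its children; the other leaves are
  untouched.\<close>

lemma simple_expansion_dacts_iff:
  assumes "((T\<^sub>1, T\<^sub>2, \<sigma>), (S\<^sub>1, S\<^sub>2, \<sigma>')) \<in> simple_expansion n"
  shows "dacts n F (T\<^sub>1, T\<^sub>2, \<sigma>) \<longleftrightarrow> dacts n F (S\<^sub>1, S\<^sub>2, \<sigma>')"
  using assms
proof cases
  case (1 l)
  have T: "T\<^sub>1 \<in> trees n"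
    using 1 by (auto simp: diagrams_def)
  have lv: "leaves (expand n T\<^sub>1 l) = leaves T\<^sub>1 - {l} \<union> (\<lambda>i. l @ [i]) ` {1..n}"
    using leaves_expand[OF T \<open>l \<in> leaves T\<^sub>1\<close>] .
  have split: "(\<forall>m\<in>leaves T\<^sub>1. Q m) \<longleftrightarrow> (\<forall>m\<in>leaves T\<^sub>1 - {l}. Q m) \<and> Q l" for Q
    using 1 by blast
  have "(\<forall>w\<in>streams {1..n}. F (l @- w) = \<sigma> l @- w) \<longleftrightarrow>
    (\<forall>i\<in>{1..n}. \<forall>w\<in>streams {1..n}. F ((l @ [i]) @- w) = (\<sigma> l @ [i]) @- w)"
    (is "?A \<longleftrightarrow> ?B")
  proof
    assume ?B
    show ?A
    proof
      fix w assume "w \<in> streams {1..n}"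
      then show "F (l @- w) = \<sigma> l @- w"
        using \<open>?B\<close> by (cases w) (auto simp: streams_Stream)
    qed
  qed (simp add: streams_Stream)
  moreover have "dacts n F (T\<^sub>1, T\<^sub>2, \<sigma>) \<longleftrightarrow>
      (\<forall>m\<in>leaves T\<^sub>1 - {l}. \<forall>w\<in>streams {1..n}. F (m @- w) = \<sigma> m @- w) \<and>
      (\<forall>w\<in>streams {1..n}. F (l @- w) = \<sigma> l @- w)"
    by (simp only: dacts_def prod.case split)
  moreover have "dacts n F (S\<^sub>1, S\<^sub>2, \<sigma>') \<longleftrightarrow>
      (\<forall>m\<in>leaves T\<^sub>1 - {l}. \<forall>w\<in>streams {1..n}. F (m @- w) = \<sigma> m @- w) \<and>
      (\<forall>i\<in>{1..n}. \<forall>w\<in>streams {1..n}. F ((l @ [i]) @- w) = (\<sigma> l @ [i]) @- w)"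
    unfolding dacts_def using 1 by (simp add: lv ball_Un)
  ultimately show ?thesis
    by blast
qed

lemma expansions_dacts_iff:
  "(d, e) \<in> (simple_expansion n)\<^sup>* \<Longrightarrow> dacts n F d \<longleftrightarrow> dacts n F e"
proof (induction rule: rtrancl_induct)
  case (step e e')
  then show ?case
    using simple_expansion_dacts_iff by (metis prod_cases3)
qed simp

lemma expansions_in_diagrams:
  "(d, e) \<in> (simple_expansion n)\<^sup>* \<Longrightarrow> d \<in> diagrams n \<Longrightarrow> e \<in> diagrams n"
proof (induction rule: rtrancl_induct)
  case (step e e')
  then show ?case
    by (metis simple_expansion.cases prod_cases3)
qed simp

section \<open>Expansion to full trees\<close>

lemma simple_expansion_exists:
  assumes d: "(T\<^sub>1, T\<^sub>2, \<sigma>) \<in> diagrams n" and l: "l \<in> leaves T\<^sub>1"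
  obtains \<sigma>' where "((T\<^sub>1, T\<^sub>2, \<sigma>), (expand n T\<^sub>1 l, expand n T\<^sub>2 (\<sigma> l), \<sigma>')) \<in> simple_expansion n"
proof -
  have T: "T\<^sub>1 \<in> trees n" "T\<^sub>2 \<in> trees n" and \<sigma>: "bij_betw \<sigma> (leaves T\<^sub>1) (leaves T\<^sub>2)"
    using d by (auto simp: diagrams_def)
  have \<sigma>l: "\<sigma> l \<in> leaves T\<^sub>2"
    using \<sigma> l by (auto simp: bij_betw_def)
  \<comment> \<open>Both \<open>m\<close> and \<open>m @ [i]\<close>, continued by \<open>i\<close>
    forever, give the same stream, so they cannot both be leaves.\<close>
  have new: "m @ [i] \<notin> leaves T" if "m \<in> leaves T" for m i T
    using leaves_antichain[OF that, of "m @ [i]" "i ## sconst i" "sconst i"] by auto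
  \<comment> \<open>On a new leaf \<open>l @ [i]\<close> the last letter recovers the child
    index.\<close>
  define \<tau> where "\<tau> m = (if m \<in> leaves T\<^sub>1 - {l} then \<sigma> m else \<sigma> l @ [last m])" for m
  have \<tau>_new: "\<tau> (l @ [i]) = \<sigma> l @ [i]" for i
    using new[OF l] by (simp add: \<tau>_def)
  define \<sigma>' where "\<sigma>' = restrict \<tau> (leaves (expand n T\<^sub>1 l))"
  have "bij_betw \<tau> (leaves T\<^sub>1 - {l} \<union> (\<lambda>i. l @ [i]) ` {1..n})
    (leaves T\<^sub>2 - {\<sigma> l} \<union> (\<lambda>i. \<sigma> l @ [i]) ` {1..n})"
  proof (rule bij_betw_combine)
    have "bij_betw \<sigma> (leaves T\<^sub>1 - {l}) (leaves T\<^sub>2 - {\<sigma> l})"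
      using \<sigma> l by (auto simp: bij_betw_def inj_on_def)
    then show "bij_betw \<tau> (leaves T\<^sub>1 - {l}) (leaves T\<^sub>2 - {\<sigma> l})"
      by (rule bij_betw_cong[THEN iffD1, rotated]) (simp add: \<tau>_def)
    show "bij_betw \<tau> ((\<lambda>i. l @ [i]) ` {1..n}) ((\<lambda>i. \<sigma> l @ [i]) ` {1..n})"
      by (simp add: bij_betw_def inj_on_def image_image \<tau>_new)
  qed (use new[OF \<sigma>l] in auto)
  then have "bij_betw \<sigma>' (leaves (expand n T\<^sub>1 l)) (leaves (expand n T\<^sub>2 (\<sigma> l)))"
    unfolding \<sigma>'_def using leaves_expand T l \<sigma>l by simp
  then have "(expand n T\<^sub>1 l, expand n T\<^sub>2 (\<sigma> l), \<sigma>') \<in> diagrams n"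
    using T l \<sigma>l by (auto simp: diagrams_def expand_in_trees \<sigma>'_def)
  moreover have "\<sigma>' m = \<sigma> m" if "m \<in> leaves T\<^sub>1 - {l}" for m
    using that leaves_expand[OF T(1) l] by (auto simp: \<sigma>'_def \<tau>_def)
  moreover have "\<sigma>' (l @ [i]) = \<sigma> l @ [i]" if "i \<in> {1..n}" for i
    using that leaves_expand[OF T(1) l] new[OF l] by (auto simp: \<sigma>'_def \<tau>_def)
  ultimately show thesis
    using that d l by (blast intro: simple_expansion.intros)
qed

lemma uniform_expansion_exists:
  assumes "n \<ge> 2" "(T\<^sub>1, T\<^sub>2, \<sigma>) \<in> diagrams n" "\<forall>l\<in>leaves T\<^sub>1. length l \<le> N"
  obtains S\<^sub>1 S\<^sub>2 \<tau> where "((T\<^sub>1, T\<^sub>2, \<sigma>), (S\<^sub>1, S\<^sub>2, \<tau>)) \<in> (simple_expansion n)\<^sup>*"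
    "\<forall>l\<in>leaves S\<^sub>1. length l = N"
proof -
  let ?L = "{l. set l \<subseteq> {1..n} \<and> length l \<le> N}"
  have fin: "finite ?L"
    by (rule finite_lists_length_le) simp
  have "\<exists>S\<^sub>1 S\<^sub>2 \<tau>. ((T\<^sub>1, T\<^sub>2, \<sigma>), (S\<^sub>1, S\<^sub>2, \<tau>)) \<in> (simple_expansion n)\<^sup>* \<and>
    (\<forall>l\<in>leaves S\<^sub>1. length l = N)"
    using assms(2,3)
  \<comment> \<open>An expansion adds \<open>n - 1\<close> leaves, hence at least one, while all
    addresses stay among the finitely many words of length at most \<open>N\<close>.\<close>
  proof (induction "card ?L - card (leaves T\<^sub>1)" arbitrary: T\<^sub>1 T\<^sub>2 \<sigma> rule: less_induct)
    case less
    show ?case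
    proof (cases "\<forall>l\<in>leaves T\<^sub>1. length l = N")
      case False
      then obtain l where l: "l \<in> leaves T\<^sub>1" "length l < N"
        using less.prems(2) by (auto simp: order_le_less)
      obtain \<sigma>' where e:
          "((T\<^sub>1, T\<^sub>2, \<sigma>), (expand n T\<^sub>1 l, expand n T\<^sub>2 (\<sigma> l), \<sigma>')) \<in> simple_expansion n"
        using simple_expansion_exists[OF less.prems(1) l(1)] .
      have T: "T\<^sub>1 \<in> trees n"
        using less.prems(1) by (auto simp: diagrams_def)
      note lv = leaves_expand[OF T l(1)]
      have e': "(expand n T\<^sub>1 l, expand n T\<^sub>2 (\<sigma> l), \<sigma>') \<in> diagrams n"
        using e less.prems(1) expansions_in_diagrams by blast
      have short: "\<forall>l\<in>leaves (expand n T\<^sub>1 l). length l \<le> N"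
        using less.prems(2) l(2) unfolding lv by auto
      have "l @ [i] \<notin> leaves T\<^sub>1" for i
        using leaves_antichain[OF l(1), of "l @ [i]" "i ## sconst i" "sconst i"] by auto
      then have "card (leaves (expand n T\<^sub>1 l)) = card (leaves T\<^sub>1) - 1 + n"
        unfolding lv using l(1) finite_leaves
        by (subst card_Un_disjoint) (auto simp: card_image inj_on_def)
      moreover have "card (leaves T\<^sub>1) > 0"
        using l(1) finite_leaves card_gt_0_iff by blast
      moreover have "card (leaves (expand n T\<^sub>1 l)) \<le> card ?L"
        using fin short e' by (intro card_mono) (auto simp: diagrams_def dest!: leaves_in_lists)
      ultimately have "card ?L - card (leaves (expand n T\<^sub>1 l)) < card ?L - card (leaves T\<^sub>1)"
        using assms(1) by linarith
      from less.hyps[OF this e' short] e show ?thesis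
        by (meson converse_rtrancl_into_rtrancl)
    qed blast
  qed
  then show thesis using that by blast
qed

text \<open>Once the first trees are the same full tree, \<open>shift_eq_imp_eq\<close> identifies
  the bijections leaf by leaf, and the second trees agree because their leaves do.\<close>

lemma diagram_equiv_iff:
  assumes "n \<ge> 2" "dacts n F d"
  shows "(d, d') \<in> diagram_equiv n \<longleftrightarrow> d \<in> diagrams n \<and> d' \<in> diagrams n \<and> dacts n F d'"
proof
  assume "(d, d') \<in> diagram_equiv n"
  then show "d \<in> diagrams n \<and> d' \<in> diagrams n \<and> dacts n F d'"
    using assms(2) expansions_dacts_iff unfolding diagram_equiv_def by blast
next
  assume R: "d \<in> diagrams n \<and> d' \<in> diagrams n \<and> dacts n F d'"
  obtain T\<^sub>1 T\<^sub>2 \<sigma> where d: "d = (T\<^sub>1, T\<^sub>2, \<sigma>)"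
    by (cases d)
  obtain T\<^sub>1' T\<^sub>2' \<sigma>' where d': "d' = (T\<^sub>1', T\<^sub>2', \<sigma>')"
    by (cases d')
  let ?N = "Max (length ` (leaves T\<^sub>1 \<union> leaves T\<^sub>1'))"
  have N: "\<forall>l\<in>leaves T\<^sub>1. length l \<le> ?N" "\<forall>l\<in>leaves T\<^sub>1'. length l \<le> ?N"
    by (auto intro!: Max_ge simp: finite_leaves)
  obtain S\<^sub>1 S\<^sub>2 \<tau> where e: "(d, (S\<^sub>1, S\<^sub>2, \<tau>)) \<in> (simple_expansion n)\<^sup>*"
      "\<forall>l\<in>leaves S\<^sub>1. length l = ?N"
    using uniform_expansion_exists[OF assms(1) _ N(1)] R d by metis
  obtain S\<^sub>1' S\<^sub>2' \<tau>' where e': "(d', (S\<^sub>1', S\<^sub>2', \<tau>')) \<in> (simple_expansion n)\<^sup>*"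
      "\<forall>l\<in>leaves S\<^sub>1'. length l = ?N"
    using uniform_expansion_exists[OF assms(1) _ N(2)] R d' by metis
  have D: "(S\<^sub>1, S\<^sub>2, \<tau>) \<in> diagrams n" "(S\<^sub>1', S\<^sub>2', \<tau>') \<in> diagrams n"
    using e e' R expansions_in_diagrams by blast+
  then have S: "S\<^sub>1' = S\<^sub>1"
    using leaves_uniform[of S\<^sub>1 n, OF _ _ e(2)] leaves_uniform[of S\<^sub>1' n, OF _ _ e'(2)] assms(1)
    by (intro leaves_inject[of _ n]) (simp_all add: diagrams_def)
  have F: "dacts n F (S\<^sub>1, S\<^sub>2, \<tau>)" "dacts n F (S\<^sub>1', S\<^sub>2', \<tau>')"
    using e(1) e'(1) assms(2) R expansions_dacts_iff by blast+
  have "\<tau> l = \<tau>' l" if "l \<in> leaves S\<^sub>1" for l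
    using F that S by (intro shift_eq_imp_eq[OF assms(1)]) (auto simp: dacts_def)
  then have \<tau>: "\<tau>' = \<tau>"
    using D S by (auto simp: diagrams_def intro!: extensionalityI[of _ "leaves S\<^sub>1"])
  then have "S\<^sub>2' = S\<^sub>2"
    using D S by (intro leaves_inject[of _ n]) (auto simp: diagrams_def bij_betw_def)
  then show "(d, d') \<in> diagram_equiv n"
    using R e(1) e'(1) S \<tau> unfolding diagram_equiv_def by blast
qed

section \<open>Leaf sequences of terms\<close>

text \<open>The leaves from left to right, each address with its label. The detour through
  \<open>map lv ts\<close> suits primitive recursion; \<open>lv_Op\<close> is the working
  form.\<close>

primrec lv :: "'v trm \<Rightarrow> (nat list \<times> 'v) list" where
  "lv (Var v) = [([], v)]"
| "lv (Op ts) = concat (map2 (\<lambda>k. map (apfst ((#) k))) [1..<Suc (length ts)] (map lv ts))"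

lemma lv_Op:
    "lv (Op ts) = concat (map (\<lambda>i. map (apfst ((#) (Suc i))) (lv (ts ! i))) [0..<length ts])"
  unfolding lv.simps by (rule arg_cong[of _ _ concat], rule nth_equalityI) (simp_all del: upt_Suc)

declare lv.simps(2) [simp del]

abbreviation addrs :: "'v trm \<Rightarrow> nat list list" where
  "addrs u \<equiv> map fst (lv u)"

abbreviation vlist :: "'v trm \<Rightarrow> 'v list" where
  "vlist u \<equiv> map snd (lv u)"

primrec shape :: "'v trm \<Rightarrow> tree" where
  "shape (Var v) = Leaf"
| "shape (Op ts) = Node (map shape ts)"

lemma shape_in_trees: "u \<in> terms n \<Longrightarrow> shape u \<in> trees n"
  by (induction rule: terms.induct) (auto intro!: trees.intros)

lemma mem_lv_Op:
  "(k # l, x) \<in> set (lv (Op ts)) \<longleftrightarrow> 1 \<le> k \<and> k \<le> length ts \<and> (l, x) \<in> set (lv (ts ! (k - 1)))"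
  by (cases k) (force simp: lv_Op image_iff)+

lemma Nil_notin_lv_Op: "([], x) \<notin> set (lv (Op ts))"
  by (auto simp: lv_Op)

lemma set_addrs: "set (addrs u) = leaves (shape u)"
proof (induction u)
  case (Op ts)
  have "l \<in> set (addrs (Op ts)) \<longleftrightarrow> l \<in> leaves (shape (Op ts))" for l
  proof (cases l)
    case Nil
    then show ?thesis
      using Nil_notin_lv_Op by force
  next
    case (Cons k m)
    have "l \<in> set (addrs (Op ts)) \<longleftrightarrow> (\<exists>x. (k # m, x) \<in> set (lv (Op ts)))"
      using Cons by force
    also have "\<dots> \<longleftrightarrow> 1 \<le> k \<and> k \<le> length ts \<and> m \<in> set (addrs (ts ! (k - 1)))"
      unfolding mem_lv_Op by force
    also have "\<dots> \<longleftrightarrow> 1 \<le> k \<and> k \<le> length ts \<and> m \<in> leaves (shape (ts ! (k - 1)))"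
    proof -
      have "ts ! (k - 1) \<in> set ts" if "1 \<le> k" "k \<le> length ts"
        using that by auto
      then show ?thesis
        using Op by blast
    qed
    finally show ?thesis
      using Cons by auto
  qed
  then show ?case by blast
qed simp

text \<open>Addresses from an earlier argument start with a smaller letter, and within one argument
  the common first letter does not affect the lexicographic order.\<close>

lemma sorted_addrs: "sorted_wrt (<) (addrs u)"
proof (induction u)
  case (Op ts)
  have "sorted_wrt (<) (concat (map (\<lambda>i. map ((#) (Suc i)) (addrs (ts ! i))) [0..<j]))"
    if "j \<le> length ts" for j
    using that
  proof (induction j)
    case (Suc j)
    have "ts ! j \<in> set ts"
      using Suc.prems by simp
    then have "sorted_wrt (<) (map ((#) (Suc j)) (addrs (ts ! j)))"
      using Op by (simp add: sorted_wrt_map)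
    then show ?case
      using Suc by (auto simp: sorted_wrt_append)
  qed simp
  from this[of "length ts"] show ?case
    by (simp add: lv_Op map_concat comp_def)
qed simp

lemma distinct_addrs: "distinct (addrs u)"
  using sorted_addrs strict_sorted_iff by blast

lemma vlist_Op: "vlist (Op ts) = concat (map vlist ts)"
proof -
  have "vlist (Op ts) = concat (map (\<lambda>i. vlist (ts ! i)) [0..<length ts])"
    by (simp add: lv_Op map_concat comp_def)
  also have "map (\<lambda>i. vlist (ts ! i)) [0..<length ts] = map vlist ts"
    by (rule nth_equalityI) simp_all
  finally show ?thesis .
qed

lemma length_lv_Op: "length (lv (Op ts)) = (\<Sum>t\<leftarrow>ts. length (lv t))"
  using arg_cong[OF vlist_Op[of ts], of length] by (simp add: length_concat comp_def)

lemma lv_nonempty: "u \<in> terms n \<Longrightarrow> n \<ge> 1 \<Longrightarrow> lv u \<noteq> []"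
proof (induction rule: terms.induct)
  case (Op ts)
  then have "hd ts \<in> set ts"
    by (intro hd_in_set) auto
  then have "vlist (hd ts) \<noteq> []" "vlist (hd ts) \<in> set (map vlist ts)"
    using Op by simp_all
  then have "vlist (Op ts) \<noteq> []"
    unfolding vlist_Op concat_eq_Nil_conv by blast
  then show ?case by simp
qed simp

text \<open>First letters separate the arguments, and the empty address occurs only in a variable.
  This later turns a trivial action into equality of terms.\<close>

lemma lv_inject:
  "u \<in> terms n \<Longrightarrow> v \<in> terms n \<Longrightarrow> set (lv u) = set (lv v) \<Longrightarrow> u = v"
proof (induction u arbitrary: v rule: terms.induct)
  case (Var x)
  show ?case
  proof (cases v)
    case (Var y)
    then show ?thesis
      using Var.prems(2) by simp
  next
    case (Op ts)
    then show ?thesis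
      using Var.prems(2) Nil_notin_lv_Op[of x ts] by auto
  qed
next
  case (Op ts)
  obtain ts' where v: "v = Op ts'"
  proof (cases v)
    case (Var y)
    then show ?thesis
      using Op.prems(2) Nil_notin_lv_Op[of y ts] by auto
  qed
  then have ts': "length ts' = n" "\<forall>t\<in>set ts'. t \<in> terms n"
    using Op.prems(1) by (auto elim: terms.cases)
  have "ts ! i = ts' ! i" if i: "i < n" for i
  proof -
    have "p \<in> set (lv (ts ! i)) \<longleftrightarrow> p \<in> set (lv (ts' ! i))" for p
      using mem_lv_Op[of "Suc i" "fst p" "snd p" ts] mem_lv_Op[of "Suc i" "fst p" "snd p" ts'] i
        ts' Op.hyps Op.prems(2)[unfolded v] by simp
    then have "set (lv (ts ! i)) = set (lv (ts' ! i))"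
      by blast
    moreover have "ts ! i \<in> set ts" "ts' ! i \<in> set ts'"
      using i ts' Op.hyps by auto
    ultimately show ?thesis
      using Op.IH ts' by blast
  qed
  then show ?case
    using v ts' Op.hyps by (auto intro: nth_equalityI)
qed

lemma concat_map_concat: "concat (map f (concat xss)) = concat (map (\<lambda>xs. concat (map f xs)) xss)"
  by (induction xss) simp_all

lemma lv_subst:
  "lv (subst \<phi> s) = concat (map (\<lambda>(l, x). map (apfst ((@) l)) (lv (\<phi> x))) (lv s))"
proof (induction s)
  case (Var x)
  have "apfst ((@) []) p = p" for p :: "nat list \<times> 'a"
    by (cases p) simp
  then show ?case by (simp add: map_idI)
next
  case (Op ts)
  have append_Cons_fun: "(@) (k # l) = (\<lambda>m. k # l @ m)" for k :: nat and l
    by (simp add: fun_eq_iff)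
  have "lv (subst \<phi> (Op ts)) =
      concat (map (\<lambda>i. map (apfst ((#) (Suc i))) (lv (subst \<phi> (ts ! i)))) [0..<length ts])"
    unfolding subst.simps lv_Op length_map
    by (intro arg_cong[of _ _ concat] map_cong refl) simp_all
  also have "\<dots> = concat (map (\<lambda>i. map (apfst ((#) (Suc i)))
      (concat (map (\<lambda>(l, x). map (apfst ((@) l)) (lv (\<phi> x))) (lv (ts ! i))))) [0..<length ts])"
    by (intro arg_cong[of _ _ concat] map_cong refl Op) simp_all
  also have "\<dots> = concat (map (\<lambda>(l, x). map (apfst ((@) l)) (lv (\<phi> x))) (lv (Op ts)))"
    unfolding lv_Op concat_map_concat
    by (simp add: map_concat comp_def case_prod_unfold apfst_compose append_Cons_fun cong: map_cong)
  finally show ?case .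
qed

section \<open>Pairs of terms acting on infinite words\<close>

definition leaf_rel ::
    "nat \<Rightarrow> (nat stream \<Rightarrow> nat stream) \<Rightarrow> nat list \<times> 'v \<Rightarrow> nat list \<times> 'v \<Rightarrow> bool" where
  "leaf_rel n F p q \<longleftrightarrow> snd p = snd q \<and> (\<forall>w\<in>streams {1..n}. F (fst p @- w) = fst q @- w)"

text \<open>Leaves are matched by position, so repeated variables cause no ambiguity.\<close>

definition acts :: "nat \<Rightarrow> (nat stream \<Rightarrow> nat stream) \<Rightarrow> 'v trm \<Rightarrow> 'v trm \<Rightarrow> bool" where
  "acts n F u v \<longleftrightarrow> list_all2 (leaf_rel n F) (lv u) (lv v)"

lemma acts_vlist: "acts n F u v \<Longrightarrow> vlist u = vlist v"
  unfolding acts_def by (induction rule: list_all2_induct) (auto simp: leaf_rel_def)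

lemma addrs_in_lists:
  assumes "u \<in> terms n" "p \<in> set (lv u)"
  shows "fst p \<in> lists {1..n}"
proof (rule leaves_in_lists[OF shape_in_trees[OF assms(1)]])
  show "fst p \<in> leaves (shape u)"
    unfolding set_addrs[symmetric] set_map using assms(2) by (rule imageI)
qed

lemma acts_refl:
  assumes "\<And>w. w \<in> streams {1..n} \<Longrightarrow> F w = w" "u \<in> terms n"
  shows "acts n F u u"
  unfolding acts_def
proof (rule list.rel_refl_strong)
  fix p assume "p \<in> set (lv u)"
  with assms(2) have "fst p \<in> lists {1..n}"
    by (rule addrs_in_lists)
  then show "leaf_rel n F p p"
    using assms(1) by (simp add: leaf_rel_def shift_streams)
qed

lemma acts_trans:
  assumes "acts n F u v" "acts n G v t"
  shows "acts n (\<lambda>w. G (F w)) u t"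
  using assms unfolding acts_def
  by (rule list_all2_trans[rotated]) (simp add: leaf_rel_def)

lemma list_all2_concat: "list_all2 (list_all2 P) xss yss \<Longrightarrow> list_all2 P (concat xss) (concat yss)"
  using concat_transfer[of P] by (auto simp: rel_fun_def)

text \<open>A change inside the \<open>k\<close>-th argument moves only words starting with
  \<open>k\<close>, and these by \<open>F\<close> behind the first letter. This carries the action
  of an equation down an address.\<close>

lemma acts_Op_update:
  assumes "acts n F (ts ! (k - 1)) v" "1 \<le> k" "k \<le> length ts"
  shows "acts n (\<lambda>w. if shd w = k then k ## F (stl w) else w) (Op ts) (Op (ts[k - 1 := v]))"
    (is "acts n ?G _ _")
  unfolding acts_def lv_Op length_list_update
proof (intro list_all2_concat, unfold list_all2_map1 list_all2_map2, rule list.rel_refl_strong)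
  fix i assume "i \<in> set [0..<length ts]"
  then have i: "i < length ts"
    by simp
  show "list_all2 (\<lambda>p q. leaf_rel n ?G (apfst ((#) (Suc i)) p) (apfst ((#) (Suc i)) q))
      (lv (ts ! i)) (lv (ts[k - 1 := v] ! i))"
  proof (cases "Suc i = k")
    case True
    then have "list_all2 (leaf_rel n F) (lv (ts ! i)) (lv (ts[k - 1 := v] ! i))"
      using assms by (auto simp: acts_def)
    then show ?thesis
      using True by (elim list_all2_mono) (simp add: leaf_rel_def)
  next
    case False
    then have "ts[k - 1 := v] ! i = ts ! i"
      using assms(2) by auto
    moreover have "leaf_rel n ?G (apfst ((#) (Suc i)) p) (apfst ((#) (Suc i)) p)" for p ::
        "nat list \<times> 'a"
      using False by (simp add: leaf_rel_def)
    ultimately show ?thesis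
      by (simp add: list.rel_refl)
  qed
qed

text \<open>A substitution appends the same suffixes below matching leaves of both sides, so all
  instances of an equation share the action of the equation itself.\<close>

lemma acts_subst:
  fixes s t :: "'v trm"
  assumes "acts n F s t" "range \<phi> \<subseteq> terms n"
  shows "acts n F (subst \<phi> s) (subst \<phi> t)"
  unfolding acts_def lv_subst
proof (intro list_all2_concat, unfold list_all2_map1 list_all2_map2)
  show "list_all2 (\<lambda>p q. list_all2 (leaf_rel n F)
      (case p of (l, x) \<Rightarrow> map (apfst ((@) l)) (lv (\<phi> x)))
      (case q of (l, x) \<Rightarrow> map (apfst ((@) l)) (lv (\<phi> x)))) (lv s) (lv t)"
    using assms(1) unfolding acts_def
  proof (rule list_all2_mono)
    fix p q :: "nat list \<times> 'v" assume pq: "leaf_rel n F p q"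
    have "leaf_rel n F (apfst ((@) (fst p)) r) (apfst ((@) (fst q)) r)" if
        "r \<in> set (lv (\<phi> (snd p)))" for r
    proof -
      have "fst r \<in> lists {1..n}"
        using that assms(2) by (intro addrs_in_lists[of "\<phi> (snd p)"]) auto
      then show ?thesis
        using pq shift_streams[of "fst r"] by (simp add: leaf_rel_def)
    qed
    then have "list_all2 (leaf_rel n F) (map (apfst ((@) (fst p))) (lv (\<phi> (snd p))))
        (map (apfst ((@) (fst q))) (lv (\<phi> (snd p))))"
      unfolding list_all2_map1 list_all2_map2 by (rule list.rel_refl_strong)
    moreover have "snd p = snd q"
      using pq by (simp add: leaf_rel_def)
    ultimately show "list_all2 (leaf_rel n F)
      (case p of (l, x) \<Rightarrow> map (apfst ((@) l)) (lv (\<phi> x)))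
      (case q of (l, x) \<Rightarrow> map (apfst ((@) l)) (lv (\<phi> x)))"
      by (simp add: case_prod_unfold)
  qed
qed

lemma acts_identity_imp_eq:
  assumes "n \<ge> 2" "u \<in> terms n" "v \<in> terms n" "acts n F u v"
    and F: "\<And>w. w \<in> streams {1..n} \<Longrightarrow> F w = w"
  shows "u = v"
proof (rule lv_inject[of _ n])
  have "list_all2 (=) (lv u) (lv v)"
  proof (rule list_all2_conv_all_nth[THEN iffD2], intro conjI allI impI)
    show "length (lv u) = length (lv v)"
      using assms(4) unfolding acts_def by (rule list_all2_lengthD)
    fix i assume i: "i < length (lv u)"
    then have r: "leaf_rel n F (lv u ! i) (lv v ! i)"
      using assms(4) list_all2_nthD unfolding acts_def by blast
    have "fst (lv u ! i) \<in> lists {1..n}"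
      using i assms(2) by (intro addrs_in_lists[of u]) auto
    then have "fst (lv u ! i) @- w = fst (lv v ! i) @- w" if "w \<in> streams {1..n}" for w
      using r that F[of "fst (lv u ! i) @- w"] shift_streams[of "fst (lv u ! i)"]
      by (simp add: leaf_rel_def)
    then have "fst (lv u ! i) = fst (lv v ! i)"
      using assms(1) by (rule shift_eq_imp_eq[rotated])
    then show "lv u ! i = lv v ! i"
      using r by (simp add: leaf_rel_def prod_eq_iff)
  qed
  then show "set (lv u) = set (lv v)"
    by (simp add: list.rel_eq)
qed (use assms in auto)

section \<open>The tree diagram of a pair of terms\<close>

text \<open>The order-preserving matching, \<open>i\<close>-th leaf to \<open>i\<close>-th leaf.
  Restriction gives the extensional form that \<open>diagrams\<close> demands.\<close>

definition diag :: "'v trm \<Rightarrow> 'v trm \<Rightarrow> diagram" where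
  "diag u v = (shape u, shape v,
     restrict (\<lambda>l. the (map_of (zip (addrs u) (addrs v)) l)) (leaves (shape u)))"

lemma map_of_addrs:
  assumes "length (lv u) = length (lv v)" "i < length (lv u)"
  shows "the (map_of (zip (addrs u) (addrs v)) (addrs u ! i)) = addrs v ! i"
  using assms distinct_addrs[of u] by (subst map_of_zip_nth) simp_all

lemma leaves_shape_nth: "l \<in> leaves (shape u) \<longleftrightarrow> (\<exists>i<length (lv u). l = addrs u ! i)"
  unfolding set_addrs[symmetric] in_set_conv_nth by auto

lemma diag_in_diagrams:
  assumes "u \<in> terms n" "v \<in> terms n" "length (lv u) = length (lv v)"
  shows "diag u v \<in> diagrams n"
proof -
  have "bij_betw (\<lambda>l. the (map_of (zip (addrs u) (addrs v)) l)) (leaves (shape u)) (leaves (shape v))"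
    unfolding bij_betw_def
  proof
    show "inj_on (\<lambda>l. the (map_of (zip (addrs u) (addrs v)) l)) (leaves (shape u))"
    proof (rule inj_onI)
      fix l m assume lm: "l \<in> leaves (shape u)" "m \<in> leaves (shape u)"
        and eq: "the (map_of (zip (addrs u) (addrs v)) l) =
            the (map_of (zip (addrs u) (addrs v)) m)"
      obtain i j where ij: "i < length (lv u)" "l = addrs u ! i" "j < length (lv u)"
          "m = addrs u ! j"
        using lm unfolding leaves_shape_nth by blast
      then have "addrs v ! i = addrs v ! j"
        using eq map_of_addrs[OF assms(3)] by simp
      then have "i = j"
        using ij assms(3) nth_eq_iff_index_eq[OF distinct_addrs[of v], of i j] by simp
      then show "l = m"
        using ij by simp
    qed
    have "l \<in> (\<lambda>l. the (map_of (zip (addrs u) (addrs v)) l)) ` leaves (shape u) \<longleftrightarrow>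
        l \<in> leaves (shape v)" for l
      unfolding image_iff Bex_def leaves_shape_nth using map_of_addrs[OF assms(3)] assms(3) by metis
    then show "(\<lambda>l. the (map_of (zip (addrs u) (addrs v)) l)) ` leaves (shape u) = leaves (shape v)"
      by blast
  qed
  then show ?thesis
    using assms by (simp add: diag_def diagrams_def shape_in_trees)
qed

lemma acts_iff:
  assumes "vlist u = vlist v"
  shows "acts n F u v \<longleftrightarrow> dacts n F (diag u v)"
proof -
  have len: "length (lv u) = length (lv v)"
    using assms map_eq_imp_length_eq by blast
  have snd: "snd (lv u ! i) = snd (lv v ! i)" if "i < length (lv u)" for i
    using arg_cong[OF assms, of "\<lambda>xs. xs ! i"] that len by simp
  have "dacts n F (diag u v) \<longleftrightarrow>
      (\<forall>l\<in>leaves (shape u). \<forall>w\<in>streams {1..n}. F (l @- w) =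
        the (map_of (zip (addrs u) (addrs v)) l) @- w)"
    by (simp add: dacts_def diag_def)
  also have "\<dots> \<longleftrightarrow> (\<forall>i<length (lv u). \<forall>w\<in>streams {1..n}. F (addrs u ! i @- w) = addrs v ! i @- w)"
    unfolding Ball_def[of "leaves _"] leaves_shape_nth using map_of_addrs[OF len] by metis
  also have "\<dots> \<longleftrightarrow> acts n F u v"
    using len snd by (auto simp: acts_def list_all2_conv_all_nth leaf_rel_def)
  finally show ?thesis ..
qed

lemma acts_exists:
  assumes "u \<in> terms n" "v \<in> terms n" "vlist u = vlist v"
  shows "\<exists>F. acts n F u v"
  using dacts_exists[OF diag_in_diagrams[OF assms(1,2)]] acts_iff[OF assms(3)]
    map_eq_imp_length_eq[OF assms(3)] by blast

lemma acts_diagram: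
  assumes "u \<in> terms n" "v \<in> terms n" "acts n F u v"
  shows "diag u v \<in> diagrams n" "dacts n F (diag u v)"
  using diag_in_diagrams[OF assms(1,2)] acts_iff acts_vlist[OF assms(3)] assms(3)
    map_eq_imp_length_eq[OF acts_vlist[OF assms(3)]] by blast+

lemma less_list_iff: "l < m \<longleftrightarrow> (l, m) \<in> lexord less_than" for l m :: "nat list"
proof -
  have "less_than = {(u, v). u < v}"
    by auto
  then show ?thesis
    by (simp only: list_less_def)
qed

lemma order_preserving_diag:
  assumes "length (lv u) = length (lv v)"
  shows "order_preserving (diag u v)"
proof -
  let ?f = "\<lambda>l. the (map_of (zip (addrs u) (addrs v)) l)"
  have "?f l < ?f m" if lm: "l \<in> leaves (shape u)" "m \<in> leaves (shape u)" "l < m" for l m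
  proof -
    obtain i j where ij: "i < length (lv u)" "l = addrs u ! i" "j < length (lv u)" "m = addrs u ! j"
      using lm(1,2) unfolding leaves_shape_nth by blast
    have "i < j"
    proof (rule ccontr)
      assume "\<not> i < j"
      then have "m \<le> l"
        using sorted_wrt_nth_less[OF sorted_addrs, of j i u] ij by (cases "i = j") auto
      then show False
        using lm(3) by simp
    qed
    then have "addrs v ! i < addrs v ! j"
      using sorted_wrt_nth_less[OF sorted_addrs, of i j v] ij assms by simp
    then show ?thesis
      using map_of_addrs[OF assms] ij by simp
  qed
  then show ?thesis
    by (simp add: order_preserving_def diag_def flip: less_list_iff)
qed

text \<open>Between two finite chains there is at most one increasing bijection: the image of the
  sorted address list is again sorted and has the right set, so it is the other address
  list.\<close>

lemma diag_eq:
  assumes "(shape u, shape v, \<sigma>) \<in> diagrams n" "order_preserving (shape u, shape v, \<sigma>)"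
  shows "diag u v = (shape u, shape v, \<sigma>)"
proof -
  have \<sigma>: "\<sigma> \<in> extensional (leaves (shape u))" "\<sigma> ` leaves (shape u) = leaves (shape v)"
    using assms(1) by (auto simp: diagrams_def bij_betw_def)
  have mono: "\<sigma> l < \<sigma> m" if "l \<in> set (addrs u)" "m \<in> set (addrs u)" "l < m" for l m
    using assms(2) that by (simp add: order_preserving_def set_addrs less_list_iff del: set_map)
  have "sorted_wrt (<) (map \<sigma> (addrs u))"
    unfolding sorted_wrt_map[of _ \<sigma>]
    using sorted_addrs by (rule sorted_wrt_mono_rel[rotated]) (rule mono)
  with sorted_addrs[of v] have eq: "map \<sigma> (addrs u) = addrs v"
  proof (rule strict_sorted_equal)
    show "set (map \<sigma> (addrs u)) = set (addrs v)"
      using \<sigma>(2) set_addrs by (metis set_map)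
  qed
  then have len: "length (lv u) = length (lv v)"
    using length_map by metis
  have "\<sigma> (addrs u ! i) = addrs v ! i" if "i < length (lv u)" for i
    using eq that by (metis length_map nth_map)
  then have "the (map_of (zip (addrs u) (addrs v)) l) = \<sigma> l" if "l \<in> leaves (shape u)" for l
    using that map_of_addrs[OF len] unfolding leaves_shape_nth by metis
  then show ?thesis
    using \<sigma>(1) by (auto simp: diag_def intro!: extensionalityI[of _ "leaves (shape u)"])
qed

section \<open>Terms with a prescribed shape\<close>

primrec fill :: "'v \<Rightarrow> tree \<Rightarrow> 'v trm" where
  "fill x Leaf = Var x"
| "fill x (Node ts) = Op (map (fill x) ts)"

lemma shape_fill: "shape (fill x T) = T"
  by (induction T) (simp_all add: map_idI)

lemma fill_in_terms: "T \<in> trees n \<Longrightarrow> fill x T \<in> terms n"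
  by (induction rule: trees.induct) (auto intro!: terms.intros)

lemma vlist_fill: "set (vlist (fill x T)) \<subseteq> {x}"
proof (induction T)
  case (Node ts)
  then show ?case
    unfolding fill.simps vlist_Op by auto
qed simp

section \<open>The generators of the structure monoid\<close>

text \<open>In terms of \<open>put\<close>, the equations of \<open>C\<^sub>n\<close> move the inner operation, which takes the \<open>n\<close>
  arguments after the first \<open>p\<close>, one place to the left.\<close>

definition put :: "nat \<Rightarrow> nat \<Rightarrow> 'v trm list \<Rightarrow> 'v trm" where
  "put n p ys = Op (take p ys @ [Op (take n (drop p ys))] @ drop (p + n) ys)"

lemma subst_put: "subst \<phi> (put n p ys) = put n p (map (subst \<phi>) ys)"
  by (simp add: put_def take_map drop_map)

lemma vlist_put: "vlist (put n p ys) = concat (map vlist ys)"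
proof -
  have "vlist (put n p ys) =
      concat (map vlist (take p ys @ take n (drop p ys) @ drop n (drop p ys)))"
    by (simp add: put_def vlist_Op add.commute del: append_take_drop_id)
  then show ?thesis
    by (simp only: append_take_drop_id)
qed

lemma put_in_terms:
  assumes "length ys = 2 * n - 1" "p < n" "set ys \<subseteq> terms n"
  shows "put n p ys \<in> terms n"
proof -
  have "set (take p ys) \<subseteq> terms n" "set (take n (drop p ys)) \<subseteq> terms n"
      "set (drop (p + n) ys) \<subseteq> terms n"
    using assms(3) set_take_subset set_drop_subset by fast+
  moreover have "length (take n (drop p ys)) = n"
    using assms by simp
  ultimately show ?thesis
    unfolding put_def using assms by (auto intro!: terms.Op)
qed

text \<open>Both sides list the same \<open>2 * n - 1\<close> variables in the same order; only the
  number of arguments before the inner operation drops from \<open>i\<close> to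
  \<open>i - 1\<close>.\<close>

lemma catalan_eqs_put:
  "catalan_eqs n x =
      {(put n i (vars x 1 (2 * n - 1)), put n (i - 1) (vars x 1 (2 * n - 1))) | i. 0 < i \<and> i < n}"
proof -
  have *: "Op (vars x 1 p @ [Op (vars x (p + 1) (p + n))] @ vars x (p + n + 1) (2 * n - 1)) =
      put n p (vars x 1 (2 * n - 1))" if "p < n" for p
    using that by (simp add: put_def vars_def take_map drop_map add_ac Suc_eq_plus1_left del: upt_Suc)
  moreover have "Op (vars x 1 (i - 1) @ [Op (vars x i (i + n - 1))] @ vars x (i + n) (2 * n - 1)) =
      put n (i - 1) (vars x 1 (2 * n - 1))" if "0 < i" "i < n" for i
    using that *[of "i - 1"] by (cases i) (simp_all add: Suc_eq_plus1 add_ac)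
  ultimately have
      "(Op (vars x 1 i @ [Op (vars x (i + 1) (i + n))] @ vars x (i + n + 1) (2 * n - 1)),
      Op (vars x 1 (i - 1) @ [Op (vars x i (i + n - 1))] @ vars x (i + n) (2 * n - 1))) =
    (put n i (vars x 1 (2 * n - 1)), put n (i - 1) (vars x 1 (2 * n - 1)))" if "0 < i" "i < n" for i
    using that by (simp only:)
  then show ?thesis
    unfolding catalan_eqs_def
        by (intro Collect_cong ex_cong1 iffI; elim conjE; intro conjI; simp only:)
qed

text \<open>Forgetting that the two positions are adjacent lets one case cover an equation and its
  reverse.\<close>

lemma catalan_eqsE:
  assumes "(s, t) \<in> catalan_eqs n x \<or> (t, s) \<in> catalan_eqs n x"
  obtains p q where "p < n" "q < n" "s = put n p (vars x 1 (2 * n - 1))"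
      "t = put n q (vars x 1 (2 * n - 1))"
proof -
  obtain i where "0 < i" "i < n"
    "s = put n i (vars x 1 (2 * n - 1)) \<and> t = put n (i - 1) (vars x 1 (2 * n - 1)) \<or>
     t = put n i (vars x 1 (2 * n - 1)) \<and> s = put n (i - 1) (vars x 1 (2 * n - 1))"
    using assms unfolding catalan_eqs_put by blast
  then show thesis
    using that[of i "i - 1"] that[of "i - 1" i] by auto
qed

lemma vars_in_terms: "set (vars x i j) \<subseteq> terms n"
  by (auto simp: vars_def intro: terms.intros)

lemma length_vars: "length (vars x 1 (2 * n - 1)) = 2 * n - 1"
  by (simp add: vars_def del: upt_Suc)

lemma subst_in_terms: "s \<in> terms n \<Longrightarrow> range \<phi> \<subseteq> terms n \<Longrightarrow> subst \<phi> s \<in> terms n"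
  by (induction rule: terms.induct) (auto intro!: terms.intros)

text \<open>Distinct variables can be sent to any list of arguments, so substitutions disappear from
  the description of the graph.\<close>

lemma rho_put:
  fixes x :: "nat \<Rightarrow> 'v"
  assumes "inj_on x {1..2 * n - 1}"
  shows "rho n (put n p (vars x 1 (2 * n - 1))) (put n q (vars x 1 (2 * n - 1))) =
    {(put n p ys, put n q ys) | ys. length ys = 2 * n - 1 \<and> set ys \<subseteq> terms n}"
proof (intro subset_antisym subsetI)
  fix r assume "r \<in> rho n (put n p (vars x 1 (2 * n - 1))) (put n q (vars x 1 (2 * n - 1)))"
  then obtain \<phi> where \<phi>: "range \<phi> \<subseteq> terms n"
    "r = (put n p (map (subst \<phi>) (vars x 1 (2 * n - 1))), put n q (map (subst \<phi>) (vars x 1 (2 * n - 1))))"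
    unfolding rho_def subst_put by blast
  then have "set (map (subst \<phi>) (vars x 1 (2 * n - 1))) \<subseteq> terms n"
    by (auto simp: vars_def simp del: upt_Suc)
  then show "r \<in> {(put n p ys, put n q ys) | ys. length ys = 2 * n - 1 \<and> set ys \<subseteq> terms n}"
    unfolding \<phi>(2)
    by (intro CollectI exI[of _ "map (subst \<phi>) (vars x 1 (2 * n - 1))"] conjI refl)
      (simp_all only: length_map length_vars)
next
  fix r :: "'v trm \<times> 'v trm"
  assume "r \<in> {(put n p ys, put n q ys) | ys. length ys = 2 * n - 1 \<and> set ys \<subseteq> terms n}"
  then obtain ys where ys: "r = (put n p ys, put n q ys)" "length ys = 2 * n - 1" "set ys \<subseteq> terms n"
    by blast
  \<comment> \<open>The variables are numbered from 1 and the list from 0, hence the offset. The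
    default \<open>Var v\<close> keeps the range inside \<open>terms n\<close>.\<close>
  define \<phi> where "\<phi> v = (if v \<in> x ` {1..2 * n - 1}
    then ys ! (inv_into {1..2 * n - 1} x v - 1) else Var v)" for v
  have "\<phi> v \<in> terms n" for v
  proof (cases "v \<in> x ` {1..2 * n - 1}")
    case True
    then have "inv_into {1..2 * n - 1} x v \<in> {1..2 * n - 1}"
      by (rule inv_into_into)
    then have "ys ! (inv_into {1..2 * n - 1} x v - 1) \<in> set ys"
      using ys(2) by (intro nth_mem) (simp add: less_diff_conv2)
    then show ?thesis
      using ys(3) True by (auto simp: \<phi>_def)
  qed (auto simp: \<phi>_def intro: terms.intros)
  moreover have "map (subst \<phi>) (vars x 1 (2 * n - 1)) = ys"
  proof (rule nth_equalityI)
    fix i assume "i < length (map (subst \<phi>) (vars x 1 (2 * n - 1)))"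
    then have i: "i < 2 * n - 1"
      unfolding length_map length_vars .
    then have "vars x 1 (2 * n - 1) ! i = Var (x (Suc i))"
      by (simp add: vars_def Suc_eq_plus1_left del: upt_Suc)
    moreover have "inv_into {1..2 * n - 1} x (x (Suc i)) = Suc i"
      by (rule inv_into_f_f[OF assms]) (use i in simp)
    moreover have "x (Suc i) \<in> x ` {1..2 * n - 1}"
      by (rule imageI) (use i in simp)
    ultimately show "map (subst \<phi>) (vars x 1 (2 * n - 1)) ! i = ys ! i"
      using i length_vars[of x n] by (simp add: \<phi>_def)
  qed (simp only: length_map length_vars ys(2))
  ultimately show "r \<in> rho n (put n p (vars x 1 (2 * n - 1))) (put n q (vars x 1 (2 * n - 1)))"
    unfolding rho_def subst_put ys(1) by (intro CollectI exI[of _ \<phi>]) auto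
qed

section \<open>Rewriting at an address\<close>

lemma rho_in_terms:
  "s \<in> terms n \<Longrightarrow> t \<in> terms n \<Longrightarrow> (u, v) \<in> rho n s t \<Longrightarrow> u \<in> terms n \<and> v \<in> terms n"
  by (auto simp: rho_def intro: subst_in_terms)

lemma rho_at_Nil: "s \<in> terms n \<Longrightarrow> t \<in> terms n \<Longrightarrow> rho_at n [] s t = rho n s t"
  unfolding rho_at_def by (auto dest: rho_in_terms)

lemma rho_at_ConsI:
  assumes "length ts = n" "set ts \<subseteq> terms n" "1 \<le> k" "k \<le> n" "(ts ! (k - 1), v) \<in> rho_at n \<alpha> s t"
  shows "(Op ts, Op (ts[k - 1 := v])) \<in> rho_at n (k # \<alpha>) s t"
proof -
  obtain w w' where "subterm_at (ts ! (k - 1)) \<alpha> = Some w" "(w, w') \<in> rho n s t"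
    "v = replace_at (ts ! (k - 1)) \<alpha> w'"
    using assms(5) unfolding rho_at_def by blast
  moreover have "Op ts \<in> terms n"
    using assms(1,2) by (auto intro!: terms.Op)
  ultimately show ?thesis
    using assms(1,3,4) unfolding rho_at_def
    by (intro CollectI exI[of _ "Op ts"] exI[of _ w] exI[of _ w']) simp
qed

lemma rho_at_ConsE:
  assumes "(u, u') \<in> rho_at n (k # \<alpha>) s t"
  obtains ts v where "u = Op ts" "u' = Op (ts[k - 1 := v])" "length ts = n" "set ts \<subseteq> terms n"
    "1 \<le> k" "k \<le> n" "(ts ! (k - 1), v) \<in> rho_at n \<alpha> s t"
proof -
  obtain w w' where u: "u \<in> terms n" "subterm_at u (k # \<alpha>) = Some w" "(w, w') \<in> rho n s t"
    "u' = replace_at u (k # \<alpha>) w'"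
    using assms unfolding rho_at_def by blast
  obtain ts where ts: "u = Op ts"
    using u(2) by (cases u) auto
  have ts': "length ts = n" "set ts \<subseteq> terms n"
    using u(1) ts by (auto elim: terms.cases)
  moreover have k: "1 \<le> k" "k \<le> n" and sub: "subterm_at (ts ! (k - 1)) \<alpha> = Some w"
    using u(2) ts ts' by (auto split: if_splits)
  moreover have "ts ! (k - 1) \<in> terms n"
    using ts' k by (intro subsetD[OF ts'(2)] nth_mem) simp
  then have "(ts ! (k - 1), replace_at (ts ! (k - 1)) \<alpha> w') \<in> rho_at n \<alpha> s t"
    using sub u(3) unfolding rho_at_def by blast
  ultimately show thesis
    using that ts u(4) by simp
qed

lemma rho_at_in_terms:
  assumes "s \<in> terms n" "t \<in> terms n" "(u, v) \<in> rho_at n \<alpha> s t"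
  shows "u \<in> terms n \<and> v \<in> terms n"
  using assms(3)
proof (induction \<alpha> arbitrary: u v)
  case Nil
  then show ?case
    using rho_in_terms[OF assms(1,2)] unfolding rho_at_Nil[OF assms(1,2)] by simp
next
  case (Cons k \<alpha>)
  obtain ts v' where ts: "u = Op ts" "v = Op (ts[k - 1 := v'])" "length ts = n" "set ts \<subseteq> terms n"
    "(ts ! (k - 1), v') \<in> rho_at n \<alpha> s t"
    using Cons.prems by (rule rho_at_ConsE)
  have "set (ts[k - 1 := v']) \<subseteq> terms n"
    using Cons.IH[OF ts(5)] ts(4) set_update_subset_insert[of ts "k - 1" v'] by blast
  then show ?case
    using ts by (auto intro!: terms.Op)
qed

lemma rho_at_sym:
  assumes "s \<in> terms n" "t \<in> terms n" "(u, v) \<in> rho_at n \<alpha> s t"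
  shows "(v, u) \<in> rho_at n \<alpha> t s"
  using assms(3)
proof (induction \<alpha> arbitrary: u v)
  case Nil
  then show ?case
    unfolding rho_at_Nil[OF assms(1,2)] rho_at_Nil[OF assms(2,1)] rho_def by auto
next
  case (Cons k \<alpha>)
  obtain ts v' where ts: "u = Op ts" "v = Op (ts[k - 1 := v'])" "length ts = n" "set ts \<subseteq> terms n"
    "1 \<le> k" "k \<le> n" "(ts ! (k - 1), v') \<in> rho_at n \<alpha> s t"
    using Cons.prems by (rule rho_at_ConsE)
  have "v' \<in> terms n"
    using rho_at_in_terms[OF assms(1,2) ts(7)] by blast
  then have "set (ts[k - 1 := v']) \<subseteq> terms n"
    using ts(4) set_update_subset_insert[of ts "k - 1" v'] by blast
  moreover have "(ts[k - 1 := v'] ! (k - 1), ts ! (k - 1)) \<in> rho_at n \<alpha> t s"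
    using Cons.IH[OF ts(7)] ts(3,5,6) by simp
  ultimately have
      "(Op (ts[k - 1 := v']), Op (ts[k - 1 := v', k - 1 := ts ! (k - 1)])) \<in> rho_at n (k # \<alpha>) t s"
    using ts(3,5,6) by (intro rho_at_ConsI) simp_all
  then show ?case
    using ts by simp
qed

lemma rho_at_acts:
  assumes "s \<in> terms n" "t \<in> terms n" "vlist s = vlist t"
  shows "\<exists>F. \<forall>(u, v)\<in>rho_at n \<alpha> s t. acts n F u v"
proof (induction \<alpha>)
  case Nil
  obtain F where "acts n F s t"
    using acts_exists[OF assms] by blast
  then have "\<forall>(u, v)\<in>rho_at n [] s t. acts n F u v"
    unfolding rho_at_Nil[OF assms(1,2)] rho_def by (auto intro: acts_subst)
  then show ?case by (rule exI[of _ F])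
next
  case (Cons k \<alpha>)
  then obtain F where F: "\<forall>(u, v)\<in>rho_at n \<alpha> s t. acts n F u v"
    by blast
  have "acts n (\<lambda>w. if shd w = k then k ## F (stl w) else w) u v" if uv:
      "(u, v) \<in> rho_at n (k # \<alpha>) s t" for u v
  proof -
    obtain ts v' where ts: "u = Op ts" "v = Op (ts[k - 1 := v'])" "length ts = n"
      "1 \<le> k" "k \<le> n" "(ts ! (k - 1), v') \<in> rho_at n \<alpha> s t"
      using uv by (rule rho_at_ConsE)
    then show ?thesis
      using F acts_Op_update[of n F ts k v'] by auto
  qed
  then have "\<forall>(u, v)\<in>rho_at n (k # \<alpha>) s t. acts n (\<lambda>w. if shd w = k then k ## F (stl w) else w) u v"
    by auto
  then show ?case by (rule exI[of _ "\<lambda>w. if shd w = k then k ## F (stl w) else w"])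
qed

text \<open>All leaves lie at depth at least \<open>k\<close>. Exact domains of composites are
  awkward to describe, but they contain all sufficiently deep terms, and this property is stable
  under composition.\<close>

fun deep :: "nat \<Rightarrow> 'v trm \<Rightarrow> bool" where
  "deep 0 u \<longleftrightarrow> True"
| "deep (Suc k) (Var v) \<longleftrightarrow> False"
| "deep (Suc k) (Op ts) \<longleftrightarrow> (\<forall>t\<in>set ts. deep k t)"

lemma deep_SucE:
  assumes "deep (Suc k) u"
  obtains ts where "u = Op ts" "\<forall>t\<in>set ts. deep k t"
  using assms by (cases u) auto

lemma deep_mono: "deep k u \<Longrightarrow> j \<le> k \<Longrightarrow> deep j u"
proof (induction k arbitrary: j u)
  case (Suc k)
  obtain ts where ts: "u = Op ts" "\<forall>t\<in>set ts. deep k t"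
    using Suc.prems(1) by (rule deep_SucE)
  then show ?case
    using Suc by (cases j) auto
qed simp

lemma deep_exists: "\<exists>u\<in>terms n. deep k (u :: 'v trm)"
proof (induction k)
  case 0
  show ?case by (auto intro: terms.Var)
next
  case (Suc k)
  then obtain u :: "'v trm" where "u \<in> terms n" "deep k u" by blast
  then show ?case
    by (intro bexI[of _ "Op (replicate n u)"]) (auto intro!: terms.Op)
qed

lemma Op_nth_eq_put:
  assumes "length ts = n" "length ss = n" "p < n" "ts ! p = Op ss"
  defines "ys \<equiv> take p ts @ ss @ drop (Suc p) ts"
  shows "Op ts = put n p ys" "length ys = 2 * n - 1"
proof -
  have "take p ys = take p ts" "take n (drop p ys) = ss" "drop (p + n) ys = drop (Suc p) ts"
    using assms by (simp_all add: ys_def)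
  then show "Op ts = put n p ys"
    using id_take_nth_drop[of p ts] assms by (simp add: put_def)
  show "length ys = 2 * n - 1"
    using assms by (simp add: ys_def)
qed

text \<open>The arguments of the inner operation lie two levels below the root, which accounts for
  the two successors.\<close>

lemma deep_eq_put:
  assumes "u \<in> terms n" "deep (Suc (Suc k)) u" "p < n"
  obtains ys where "u = put n p ys" "length ys = 2 * n - 1" "set ys \<subseteq> terms n" "\<forall>y\<in>set ys. deep k y"
proof -
  obtain ts where ts: "u = Op ts" "\<forall>t\<in>set ts. deep (Suc k) t"
    using assms(2) by (rule deep_SucE)
  have ts': "length ts = n" "set ts \<subseteq> terms n"
    using assms(1) ts(1) by (auto elim: terms.cases)
  have p: "ts ! p \<in> set ts"
    using ts' assms(3) by simp
  then obtain ss where ss: "ts ! p = Op ss" "\<forall>t\<in>set ss. deep k t"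
    using ts(2) by (meson deep_SucE)
  have "ts ! p \<in> terms n"
    using p ts' by blast
  then have ss': "length ss = n" "set ss \<subseteq> terms n"
    using ss(1) by (auto elim: terms.cases)
  have sub: "set (take p ts @ ss @ drop (Suc p) ts) \<subseteq> set ts \<union> set ss"
    using set_take_subset[of p ts] set_drop_subset[of "Suc p" ts] by auto
  show thesis
  proof (rule that)
    show "u = put n p (take p ts @ ss @ drop (Suc p) ts)"
        "length (take p ts @ ss @ drop (Suc p) ts) = 2 * n - 1"
      using Op_nth_eq_put[OF ts'(1) ss'(1) assms(3) ss(1)] ts(1) by simp_all
    show "set (take p ts @ ss @ drop (Suc p) ts) \<subseteq> terms n"
      using sub ts'(2) ss'(2) by blast
    show "\<forall>y\<in>set (take p ts @ ss @ drop (Suc p) ts). deep k y"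
      using sub ts(2) ss(2) deep_mono[of "Suc k" _ k] by auto
  qed
qed

lemma deep_put:
  assumes "\<forall>y\<in>set ys. deep k y"
  shows "deep k (put n p ys)"
proof -
  have "deep k y" if "y \<in> set (take p ys) \<union> set (take n (drop p ys)) \<union> set (drop (p + n) ys)" for y
    using assms that by (auto dest!: in_set_takeD in_set_dropD)
  then have "deep (Suc k) (put n p ys)" if "k > 0"
    using deep_mono[of k _ "k - 1"] that by (cases k) (auto simp: put_def)
  then show ?thesis
    using deep_mono[of "Suc k" _ k] by (cases k) auto
qed

text \<open>Depth \<open>length \<alpha> + 2\<close> guarantees both operations of the pattern at
  the address. The estimate gives up two levels at the rewritten subterm; terms beside the path are
  unchanged.\<close>

lemma rho_at_deep:
  assumes "inj_on x {1..2 * n - 1}" "p < n" "q < n" "set \<alpha> \<subseteq> {1..n}"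
    and "u \<in> terms n" "deep (length \<alpha> + 2 + k) u"
  shows "\<exists>v. (u, v) \<in> rho_at n \<alpha> (put n p (vars x 1 (2 * n - 1))) (put n q (vars x 1 (2 * n - 1))) \<and>
    deep (length \<alpha> + k) v"
  using assms(4-6)
proof (induction \<alpha> arbitrary: u)
  case Nil
  have "deep (Suc (Suc k)) u"
    using Nil.prems(3) by simp
  with Nil.prems(2) obtain ys where ys: "u = put n p ys" "length ys = 2 * n - 1" "set ys \<subseteq> terms n"
    "\<forall>y\<in>set ys. deep k y"
    using assms(2) by (rule deep_eq_put)
  moreover have "put n r (vars x 1 (2 * n - 1)) \<in> terms n" if "r < n" for r
    using length_vars that vars_in_terms by (rule put_in_terms)
  ultimately show ?case
    using assms(2,3) deep_put[OF ys(4)] rho_put[OF assms(1), of p q] by (auto simp: rho_at_Nil)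
next
  case (Cons k' \<alpha>)
  let ?s = "put n p (vars x 1 (2 * n - 1))" and ?t = "put n q (vars x 1 (2 * n - 1))"
  have "deep (Suc (length \<alpha> + 2 + k)) u"
    using Cons.prems(3) by simp
  then obtain ts where ts: "u = Op ts" "\<forall>t\<in>set ts. deep (length \<alpha> + 2 + k) t"
    by (rule deep_SucE)
  have ts': "length ts = n" "set ts \<subseteq> terms n" and k': "1 \<le> k'" "k' \<le> n"
    using Cons.prems(1,2) ts(1) by (auto elim: terms.cases)
  then have t: "ts ! (k' - 1) \<in> set ts"
    by simp
  then obtain v where v: "(ts ! (k' - 1), v) \<in> rho_at n \<alpha> ?s ?t" "deep (length \<alpha> + k) v"
    using Cons.IH[of "ts ! (k' - 1)"] Cons.prems(1) ts(2) ts'(2) by auto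
  have "\<forall>t\<in>set ts. deep (length \<alpha> + k) t"
    using ts(2) deep_mono[of "length \<alpha> + 2 + k" _ "length \<alpha> + k"] by fastforce
  then have "\<forall>t\<in>set (ts[k' - 1 := v]). deep (length \<alpha> + k) t"
    using v(2) set_update_subset_insert[of ts "k' - 1" v] by blast
  then show ?case
    using rho_at_ConsI[OF ts' k' v(1)] ts(1) by auto
qed

section \<open>The structure monoid\<close>

definition sact :: "nat \<Rightarrow> (nat stream \<Rightarrow> nat stream) \<Rightarrow> ('v trm \<times> 'v trm) set \<Rightarrow> bool" where
  "sact n F f \<longleftrightarrow> (\<forall>(u, v)\<in>f. acts n F u v)"

lemma struct_generatorD:
  assumes "(s, t) \<in> catalan_eqs n x \<or> (t, s) \<in> catalan_eqs n x"
  shows "s \<in> terms n" "t \<in> terms n" "vlist s = vlist t"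
proof -
  obtain p q where "p < n" "q < n" "s = put n p (vars x 1 (2 * n - 1))"
      "t = put n q (vars x 1 (2 * n - 1))"
    using assms by (rule catalan_eqsE)
  then show "s \<in> terms n" "t \<in> terms n" "vlist s = vlist t"
    using put_in_terms[OF length_vars _ vars_in_terms] by (simp_all add: vlist_put)
qed

lemma struct_carrier_in_terms:
  "f \<in> struct_carrier n x \<Longrightarrow> (u, v) \<in> f \<Longrightarrow> u \<in> terms n \<and> v \<in> terms n"
proof (induction arbitrary: u v rule: struct_carrier.induct)
  case (gen s t \<alpha>)
  then show ?case
    using rho_at_in_terms[OF struct_generatorD(1,2)[OF gen(1)]] by simp
next
  case (comp f g)
  from comp.prems obtain w where "(u, w) \<in> f" "(w, v) \<in> g"
    by (rule relcompEpair)
  then show ?case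
    using comp.IH by simp
qed auto

text \<open>Generators come in mutually inverse pairs, one for each orientation of an
  equation.\<close>

lemma struct_carrier_converse:
  "f \<in> struct_carrier n x \<Longrightarrow> f\<inverse> \<in> struct_carrier n x"
proof (induction rule: struct_carrier.induct)
  case one
  then show ?case by (simp add: struct_carrier.one)
next
  case (gen s t \<alpha>)
  then have "(rho_at n \<alpha> s t)\<inverse> = rho_at n \<alpha> t s"
    using rho_at_sym[OF struct_generatorD(1,2)[OF gen(1)]]
      rho_at_sym[OF struct_generatorD(2,1)[OF gen(1)]]
    by (intro subset_antisym subrelI) (simp_all only: converse_iff)
  moreover have "rho_at n \<alpha> t s \<in> struct_carrier n x"
    using gen by (blast intro: struct_carrier.gen)
  ultimately show ?case by simp
next
  case (comp f g)
  then show ?case by (simp add: converse_relcomp struct_carrier.comp)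
qed

lemma sactI: "(\<And>u v. (u, v) \<in> f \<Longrightarrow> acts n F u v) \<Longrightarrow> sact n F f"
  unfolding sact_def by (rule ballI) (simp add: case_prod_beta)

lemma sactD: "sact n F f \<Longrightarrow> (u, v) \<in> f \<Longrightarrow> acts n F u v"
  unfolding sact_def by (drule (1) bspec) simp

lemma sact_relcomp:
  assumes "sact n F f" "sact n G g"
  shows "sact n (\<lambda>w. G (F w)) (f O g)"
proof (rule sactI)
  fix u t assume "(u, t) \<in> f O g"
  then obtain v where "(u, v) \<in> f" "(v, t) \<in> g"
    by (rule relcompEpair)
  then show "acts n (\<lambda>w. G (F w)) u t"
    by (rule acts_trans[OF sactD[OF assms(1)] sactD[OF assms(2)]])
qed

lemma sact_exists:
  fixes x :: "nat \<Rightarrow> 'v"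
  shows "f \<in> struct_carrier n x \<Longrightarrow> \<exists>F. sact n F f"
proof (induction rule: struct_carrier.induct)
  case one
  have "sact n id (Id_on (terms n :: 'v trm set))"
    by (rule sactI) (auto intro!: acts_refl)
  then show ?case by (rule exI[of _ id])
next
  case (gen s t \<alpha>)
  show ?case
    unfolding sact_def by (rule rho_at_acts[OF struct_generatorD[OF gen(1)]])
next
  case (comp f g)
  obtain F where F: "sact n F f"
    using comp.IH(1) by (elim exE)
  obtain G where G: "sact n G g"
    using comp.IH(2) by (elim exE)
  show ?case
    by (rule exI[of _ "\<lambda>w. G (F w)"]) (rule sact_relcomp[OF F G])
qed

text \<open>The surplus \<open>k\<close> is quantified so that the bounds add: from depth
  \<open>N + M + k\<close> the first factor leaves the depth \<open>M + k\<close> that the second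
  one asks for.\<close>

lemma struct_carrier_deep:
  assumes "inj_on x {1..2 * n - 1}" "f \<in> struct_carrier n x"
  shows "\<exists>N. \<forall>k. \<forall>u\<in>terms n. deep (N + k) u \<longrightarrow> (\<exists>v. (u, v) \<in> f \<and> deep k v)"
  using assms(2)
proof (induction rule: struct_carrier.induct)
  case one
  then show ?case by (intro exI[of _ 0]) auto
next
  case (gen s t \<alpha>)
  obtain p q where pq: "p < n" "q < n" "s = put n p (vars x 1 (2 * n - 1))"
      "t = put n q (vars x 1 (2 * n - 1))"
    using gen(1) by (rule catalan_eqsE)
  have "\<exists>v. (u, v) \<in> rho_at n \<alpha> s t \<and> deep k v" if "u \<in> terms n" "deep (length \<alpha> + 2 + k) u" for k u
    using rho_at_deep[OF assms(1) pq(1,2) gen(2) that] deep_mono[of "length \<alpha> + k" _ k]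
    unfolding pq(3,4) by (meson le_add2)
  then show ?case by (intro exI[of _ "length \<alpha> + 2"]) simp
next
  case (comp f g)
  obtain N where N: "\<forall>k. \<forall>u\<in>terms n. deep (N + k) u \<longrightarrow> (\<exists>v. (u, v) \<in> f \<and> deep k v)"
    using comp.IH(1) by (elim exE)
  obtain M where M: "\<forall>k. \<forall>u\<in>terms n. deep (M + k) u \<longrightarrow> (\<exists>v. (u, v) \<in> g \<and> deep k v)"
    using comp.IH(2) by (elim exE)
  have "\<exists>v. (u, v) \<in> f O g \<and> deep k v" if u: "u \<in> terms n" "deep (N + M + k) u" for k u
  proof -
    obtain v where v: "(u, v) \<in> f" "deep (M + k) v"
      using N u by (metis add.assoc)
    then obtain t where "(v, t) \<in> g" "deep k t"
      using M struct_carrier_in_terms[OF comp.hyps(1) v(1)] by metis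
    then show ?thesis
      using v(1) by (intro exI[of _ t]) auto
  qed
  then show ?case by (intro exI[of _ "N + M"]) simp
qed

lemma struct_carrier_nonempty:
  assumes "inj_on x {1..2 * n - 1}" "f \<in> struct_carrier n x"
  obtains u v where "(u, v) \<in> f"
proof -
  obtain N where N: "\<forall>k. \<forall>u\<in>terms n. deep (N + k) u \<longrightarrow> (\<exists>v. (u, v) \<in> f \<and> deep k v)"
    using struct_carrier_deep[OF assms] by blast
  obtain u :: "'a trm" where "u \<in> terms n" "deep (N + 0) u"
    using deep_exists by blast
  then show thesis
    using N that by metis
qed

text \<open>Prefixing all addresses with \<open>k\<close> moves a composite of generators into the
  \<open>k\<close>-th argument. Only an inclusion is claimed because the unit is sent to the unit,
  which also relates variables.\<close>

lemma struct_carrier_Op: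
  assumes "f \<in> struct_carrier n x" "1 \<le> k" "k \<le> n"
  obtains g where "g \<in> struct_carrier n x"
    "\<And>ts v. length ts = n \<Longrightarrow> set ts \<subseteq> terms n \<Longrightarrow> (ts ! (k - 1), v) \<in> f \<Longrightarrow>
      (Op ts, Op (ts[k - 1 := v])) \<in> g"
  using assms(1)
proof (induction arbitrary: thesis rule: struct_carrier.induct)
  case one
  show ?case
  proof (rule one[OF struct_carrier.one])
    fix ts :: "'a trm list" and v
    assume ts: "length ts = n" "set ts \<subseteq> terms n" "(ts ! (k - 1), v) \<in> Id_on (terms n)"
    then have "v = ts ! (k - 1)"
      by (auto simp: Id_on_iff)
    moreover have "Op ts \<in> terms n"
      using ts(1,2) by (auto intro!: terms.Op)
    ultimately show "(Op ts, Op (ts[k - 1 := v])) \<in> Id_on (terms n)"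
      by (simp add: Id_on_iff)
  qed
next
  case (gen s t \<alpha>)
  have "rho_at n (k # \<alpha>) s t \<in> struct_carrier n x"
    using gen(2) assms(2,3) by (intro struct_carrier.gen[OF gen(1)]) auto
  then show ?case
    by (rule gen(3)) (rule rho_at_ConsI[OF _ _ assms(2,3)])
next
  case (comp f g)
  obtain f' where f': "f' \<in> struct_carrier n x" "\<And>ts v. length ts = n \<Longrightarrow> set ts \<subseteq> terms n \<Longrightarrow>
      (ts ! (k - 1), v) \<in> f \<Longrightarrow> (Op ts, Op (ts[k - 1 := v])) \<in> f'"
    using comp.IH(1) that by metis
  obtain g' where g': "g' \<in> struct_carrier n x" "\<And>ts v. length ts = n \<Longrightarrow> set ts \<subseteq> terms n \<Longrightarrow>
      (ts ! (k - 1), v) \<in> g \<Longrightarrow> (Op ts, Op (ts[k - 1 := v])) \<in> g'"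
    using comp.IH(2) that by metis
  show ?case
  proof (rule comp.prems[OF struct_carrier.comp[OF f'(1) g'(1)]])
    fix ts v assume ts: "length ts = n" "set ts \<subseteq> terms n" "(ts ! (k - 1), v) \<in> f O g"
    from ts(3) obtain w where w: "(ts ! (k - 1), w) \<in> f" "(w, v) \<in> g"
      by (rule relcompEpair)
    have "set (ts[k - 1 := w]) \<subseteq> terms n"
      using struct_carrier_in_terms[OF comp.hyps(1) w(1)] ts(2) set_update_subset_insert[of ts
        "k - 1" w] by blast
    moreover have "(ts[k - 1 := w] ! (k - 1), v) \<in> g"
      using w(2) ts(1) assms(2,3) by simp
    ultimately have "(Op (ts[k - 1 := w]), Op (ts[k - 1 := w, k - 1 := v])) \<in> g'"
      using ts(1) by (intro g'(2)) simp_all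
    then show "(Op ts, Op (ts[k - 1 := v])) \<in> f' O g'"
      using f'(2)[OF ts(1,2) w(1)] by auto
  qed
qed

lemma sact_unique:
  assumes "inj_on x {1..2 * n - 1}" "f \<in> struct_carrier n x" "sact n F f" "sact n G f"
      "w \<in> streams {1..n}"
  shows "F w = G w"
proof -
  obtain u v where uv: "(u, v) \<in> f"
    using struct_carrier_nonempty[OF assms(1,2)] .
  then have t: "u \<in> terms n" "v \<in> terms n"
    using struct_carrier_in_terms[OF assms(2)] by simp_all
  note F = acts_diagram[OF t sactD[OF assms(3) uv]]
  note G = acts_diagram[OF t sactD[OF assms(4) uv]]
  show ?thesis
    using F(1) F(2) G(2) assms(5) by (rule dacts_unique)
qed

lemma sact_cong:
  assumes "f \<in> struct_carrier n x" "sact n F f" "\<And>w. w \<in> streams {1..n} \<Longrightarrow> F w = G w"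
  shows "sact n G f"
proof -
  have uv: "u \<in> terms n" "v \<in> terms n" "acts n F u v" if "(u, v) \<in> f" for u v
    using struct_carrier_in_terms[OF assms(1) that] sactD[OF assms(2) that] by simp_all
  show ?thesis
  proof (rule sactI)
    fix u v assume "(u, v) \<in> f"
    note uv = uv[OF this]
    have "dacts n G (diag u v)"
      using acts_diagram[OF uv] dacts_cong[where d = "diag u v", OF assms(3)] by simp
    then show "acts n G u v"
      unfolding acts_iff[OF acts_vlist[OF uv(3)]] .
  qed
qed

text \<open>Extensionality turns agreement on \<open>streams {1..n}\<close> into equality of
  functions, so that the kernel can be expressed by \<open>act n f = act n g\<close>.\<close>

definition act :: "nat \<Rightarrow> ('v trm \<times> 'v trm) set \<Rightarrow> nat stream \<Rightarrow> nat stream" where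
  "act n f = (SOME F. F \<in> extensional (streams {1..n}) \<and> sact n F f)"

lemma act:
  assumes "f \<in> struct_carrier n x"
  shows "act n f \<in> extensional (streams {1..n})" "sact n (act n f) f"
proof -
  obtain F where F: "sact n F f"
    using sact_exists[OF assms] by (elim exE)
  have "sact n (restrict F (streams {1..n})) f"
    using assms F by (rule sact_cong) simp
  then have "restrict F (streams {1..n}) \<in> extensional (streams {1..n}) \<and>
      sact n (restrict F (streams {1..n})) f"
    by simp
  then have "act n f \<in> extensional (streams {1..n}) \<and> sact n (act n f) f"
    unfolding act_def by (rule someI[of "\<lambda>F. F \<in> extensional (streams {1..n}) \<and> sact n F f"])
  then show "act n f \<in> extensional (streams {1..n})" "sact n (act n f) f"
    by auto
qed

lemma act_eqI:
  assumes "inj_on x {1..2 * n - 1}" "f \<in> struct_carrier n x" "sact n F f" "w \<in> streams {1..n}"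
  shows "act n f w = F w"
  using sact_unique[OF assms(1,2) act(2)[OF assms(2)] assms(3,4)] .

lemma act_relcomp:
  assumes "inj_on x {1..2 * n - 1}" "f \<in> struct_carrier n x" "g \<in> struct_carrier n x"
      "w \<in> streams {1..n}"
  shows "act n (f O g) w = act n g (act n f w)"
  by (rule act_eqI[OF assms(1) struct_carrier.comp[OF assms(2,3)]
      sact_relcomp[OF act(2)[OF assms(2)] act(2)[OF assms(3)]] assms(4)])

lemma act_Id_on:
  fixes x :: "nat \<Rightarrow> 'v"
  assumes "inj_on x {1..2 * n - 1}" "w \<in> streams {1..n}"
  shows "act n (Id_on (terms n :: 'v trm set)) w = w"
proof (rule act_eqI[OF assms(1) struct_carrier.one _ assms(2)])
  show "sact n (\<lambda>w. w) (Id_on (terms n :: 'v trm set))"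
    by (rule sactI) (auto intro!: acts_refl)
qed

lemma diag_acts:
  assumes "f \<in> struct_carrier n x" "(u, v) \<in> f"
  shows "diag u v \<in> diagrams n" "dacts n (act n f) (diag u v)"
proof -
  have "u \<in> terms n" "v \<in> terms n"
    using struct_carrier_in_terms[OF assms] by simp_all
  then show "diag u v \<in> diagrams n" "dacts n (act n f) (diag u v)"
    using sactD[OF act(2)[OF assms(1)] assms(2)] by (rule acts_diagram)+
qed

text \<open>The action is an idempotent map that is also surjective, and such a map is the
  identity.\<close>

lemma idempotent_act:
  assumes "inj_on x {1..2 * n - 1}" "e \<in> struct_carrier n x" "e O e = e" "w \<in> streams {1..n}"
  shows "act n e w = w"
proof -
  obtain u v where "(u, v) \<in> e"
    using struct_carrier_nonempty[OF assms(1,2)] .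
  then have "diag u v \<in> diagrams n" "dacts n (act n e) (diag u v)"
    using diag_acts[OF assms(2)] by simp_all
  then obtain w' where "w' \<in> streams {1..n}" "act n e w' = w"
    using assms(4) by (rule dacts_surj)
  then show ?thesis
    using act_relcomp[OF assms(1,2,2), of w'] assms(3) by simp
qed

text \<open>A trivial action puts \<open>e\<close> inside the identity relation, where every
  relation is idempotent.\<close>

lemma act_identity_idempotent:
  assumes "n \<ge> 2" "e \<in> struct_carrier n x" "\<And>w. w \<in> streams {1..n} \<Longrightarrow> act n e w = w"
  shows "e O e = e"
proof -
  have "u = v" if "(u, v) \<in> e" for u v
  proof (rule acts_identity_imp_eq[OF assms(1)])
    show "acts n (act n e) u v"
      using act(2)[OF assms(2)] that by (rule sactD)
  qed (use struct_carrier_in_terms[OF assms(2) that] assms(3) in simp_all)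
  then have "e \<subseteq> Id"
    by auto
  then show ?thesis
    by auto
qed

text \<open>The composite contains a pair \<open>(u, u)\<close>, and this one pair already fixes the
  action.\<close>

lemma act_relcomp_converse:
  assumes "inj_on x {1..2 * n - 1}" "f \<in> struct_carrier n x" "w \<in> streams {1..n}"
  shows "act n (f O f\<inverse>) w = w"
proof -
  have f: "f O f\<inverse> \<in> struct_carrier n x"
    using assms(2) by (intro struct_carrier.comp struct_carrier_converse)
  obtain u v where uv: "(u, v) \<in> f"
    using struct_carrier_nonempty[OF assms(1,2)] .
  then have u: "(u, u) \<in> f O f\<inverse>" "u \<in> terms n"
    using struct_carrier_in_terms[OF assms(2)] by auto
  have "acts n (\<lambda>w. w) u u"
    using u(2) by (intro acts_refl) simp_all
  then have "dacts n (\<lambda>w. w) (diag u u)"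
    using u(2) by (intro acts_diagram(2))
  then show ?thesis
    using dacts_unique[OF diag_acts[OF f u(1)] _ assms(3)] by simp
qed

section \<open>The congruence on the structure monoid\<close>

lemma struct_monoid_simps [simp]:
  "carrier (struct_monoid n x) = struct_carrier n x"
  "f \<otimes>\<^bsub>struct_monoid n x\<^esub> g = f O g"
  "\<one>\<^bsub>struct_monoid n x\<^esub> = Id_on (terms n)"
  by (simp_all add: struct_monoid_def)

lemma monoid_struct_monoid: "monoid (struct_monoid n x)"
proof (rule monoidI)
  fix f assume "f \<in> carrier (struct_monoid n x)"
  then have "u \<in> terms n \<and> v \<in> terms n" if "(u, v) \<in> f" for u v
    using struct_carrier_in_terms[OF _ that] by simp
  then show "\<one>\<^bsub>struct_monoid n x\<^esub> \<otimes>\<^bsub>struct_monoid n x\<^esub> f = f"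
    "f \<otimes>\<^bsub>struct_monoid n x\<^esub> \<one>\<^bsub>struct_monoid n x\<^esub> = f"
    by auto
qed (auto intro: struct_carrier.intros(1,3))

text \<open>The action is multiplicative and trivial on idempotents, hence constant on congruence
  classes. Conversely, equal actions make \<open>f O g\<inverse>\<close> act trivially, so it is
  idempotent.\<close>

lemma idem_cong_struct_iff:
  fixes x :: "nat \<Rightarrow> 'v"
  assumes "n \<ge> 2" "inj_on x {1..2 * n - 1}"
  shows "(f, g) \<in> idem_cong (struct_monoid n x) \<longleftrightarrow>
    f \<in> struct_carrier n x \<and> g \<in> struct_carrier n x \<and> act n f = act n g"
proof
  assume "(f, g) \<in> idem_cong (struct_monoid n x)"
  then show "f \<in> struct_carrier n x \<and> g \<in> struct_carrier n x \<and> act n f = act n g"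
  proof (induction rule: idem_cong.induct)
    case (idem e)
    then have "e \<in> struct_carrier n x" "e O e = e"
      by simp_all
    then have "act n e = act n (Id_on (terms n :: 'v trm set))"
      using idempotent_act[OF assms(2)] act_Id_on[OF assms(2)]
      by (intro extensionalityI[of _ "streams {1..n}"] act(1)[of _ n x] struct_carrier.one) simp_all
    then show ?case
      using idem by (simp add: struct_carrier.one)
  next
    case (mult a b c d)
    then have "act n (a O c) w = act n (b O d) w" if "w \<in> streams {1..n}" for w
      using act_relcomp[OF assms(2) _ _ that] by simp
    then have "act n (a O c) = act n (b O d)"
      using mult.IH
      by (intro extensionalityI[of _ "streams {1..n}"] act(1)[of _ n x] struct_carrier.comp) auto
    then show ?case
      using mult.IH by (simp add: struct_carrier.comp)
  qed auto
next
  let ?M = "struct_monoid n x"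
  assume fg: "f \<in> struct_carrier n x \<and> g \<in> struct_carrier n x \<and> act n f = act n g"
  then have g': "g\<inverse> \<in> struct_carrier n x"
    by (intro struct_carrier_converse) simp
  have eq: "act n (f O g\<inverse>) w = w" "act n (g\<inverse> O g) w = w" if w: "w \<in> streams {1..n}" for w
  proof -
    show "act n (g\<inverse> O g) w = w"
      using act_relcomp_converse[OF assms(2) g' w] by simp
    have "act n (f O g\<inverse>) w = act n (g O g\<inverse>) w"
      using act_relcomp[OF assms(2) _ g' w] fg by simp
    then show "act n (f O g\<inverse>) w = w"
      using act_relcomp_converse[OF assms(2) _ w] fg by simp
  qed
  have e: "f O g\<inverse> \<in> struct_carrier n x" "g\<inverse> O g \<in> struct_carrier n x"
    using fg g' by (auto intro: struct_carrier.comp)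
  have 1: "(f O g\<inverse>, Id_on (terms n)) \<in> idem_cong ?M" "(g\<inverse> O g, Id_on (terms n)) \<in> idem_cong ?M"
    using idem_cong.idem[of _ ?M] e act_identity_idempotent[OF assms(1) e(1) eq(1)]
      act_identity_idempotent[OF assms(1) e(2) eq(2)] by simp_all
  \<comment> \<open>The product of \<open>f\<close>, \<open>g\<inverse>\<close> and
    \<open>g\<close>, bracketed in the two ways, is congruent to \<open>f\<close> and to
    \<open>g\<close>.\<close>
  have "(f O (g\<inverse> O g), f O Id_on (terms n)) \<in> idem_cong ?M"
    using idem_cong.mult[OF idem_cong.refl[of f ?M] 1(2)] fg by simp
  moreover have "((f O g\<inverse>) O g, Id_on (terms n) O g) \<in> idem_cong ?M"
    using idem_cong.mult[OF 1(1) idem_cong.refl[of g ?M]] fg by simp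
  moreover have "f O Id_on (terms n) = f" "Id_on (terms n) O g = g"
    using monoid.r_one[OF monoid_struct_monoid, of f n x] monoid.l_one[OF monoid_struct_monoid,
      of g n x] fg
    by simp_all
  ultimately show "(f, g) \<in> idem_cong ?M"
    by (metis O_assoc idem_cong.sym idem_cong.trans)
qed

section \<open>Right combs\<close>

definition reach :: "nat \<Rightarrow> (nat \<Rightarrow> 'v) \<Rightarrow> 'v trm \<Rightarrow> 'v trm \<Rightarrow> bool" where
  "reach n x u v \<longleftrightarrow> (\<exists>f\<in>struct_carrier n x. (u, v) \<in> f)"

lemma reach_refl: "u \<in> terms n \<Longrightarrow> reach n x u u"
  unfolding reach_def by (intro bexI[OF _ struct_carrier.one]) auto

lemma reach_trans: "reach n x u v \<Longrightarrow> reach n x v w \<Longrightarrow> reach n x u w"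
  unfolding reach_def using struct_carrier.comp by blast

lemma reach_sym: "reach n x u v \<Longrightarrow> reach n x v u"
  unfolding reach_def using struct_carrier_converse by blast

lemma reach_in_terms: "reach n x u v \<Longrightarrow> u \<in> terms n \<and> v \<in> terms n"
  unfolding reach_def using struct_carrier_in_terms by blast

lemma reach_vlist:
  assumes "reach n x u v"
  shows "vlist u = vlist v"
proof -
  obtain f where "f \<in> struct_carrier n x" "(u, v) \<in> f"
    using assms unfolding reach_def by (elim bexE)
  then show ?thesis
    by (intro acts_vlist[OF sactD[OF act(2)]])
qed

lemma reach_last:
  assumes "reach n x r r'" "length ts = n - 1" "n \<ge> 1" "set ts \<subseteq> terms n"
  shows "reach n x (Op (ts @ [r])) (Op (ts @ [r']))"
proof -
  obtain f where f: "f \<in> struct_carrier n x" "(r, r') \<in> f"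
    using assms(1) unfolding reach_def by (elim bexE)
  obtain g where g: "g \<in> struct_carrier n x" "\<And>ts v. length ts = n \<Longrightarrow> set ts \<subseteq> terms n \<Longrightarrow>
      (ts ! (n - 1), v) \<in> f \<Longrightarrow> (Op ts, Op (ts[n - 1 := v])) \<in> g"
    using struct_carrier_Op[OF f(1) assms(3) order_refl] by metis
  have "(Op (ts @ [r]), Op ((ts @ [r])[n - 1 := r'])) \<in> g"
    using f(2) assms(2-4) reach_in_terms[OF assms(1)] by (intro g(2)) (simp_all add: nth_append)
  then have "(Op (ts @ [r]), Op (ts @ [r'])) \<in> g"
    using assms(2) by (simp add: list_update_append)
  then show ?thesis
    using g(1) unfolding reach_def by (intro bexI)
qed

lemma reach_put:
  assumes "inj_on x {1..2 * n - 1}" "p \<le> q" "q < n" "length ys = 2 * n - 1" "set ys \<subseteq> terms n"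
  shows "reach n x (put n p ys) (put n q ys)"
  using assms(2,3)
proof (induction q rule: dec_induct)
  case base
  then show ?case
    using assms by (intro reach_refl put_in_terms)
next
  case (step q)
  let ?V = "vars x 1 (2 * n - 1)"
  have V: "put n q ?V \<in> terms n" "put n (Suc q) ?V \<in> terms n"
    using step.prems by (auto intro!: put_in_terms[OF length_vars _ vars_in_terms])
  \<comment> \<open>The equation moves the inner operation to the left; the generator used here is
    its reverse.\<close>
  have "(put n (Suc q) ?V, put n q ?V) \<in> catalan_eqs n x"
    unfolding catalan_eqs_put using step.prems by (intro CollectI exI[of _ "Suc q"]) simp
  then have "rho_at n [] (put n q ?V) (put n (Suc q) ?V) \<in> struct_carrier n x"
    by (intro struct_carrier.gen) simp_all
  moreover have "(put n q ys, put n (Suc q) ys) \<in> rho_at n [] (put n q ?V) (put n (Suc q) ?V)"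
    unfolding rho_at_Nil[OF V] rho_put[OF assms(1)] using assms(4,5) by blast
  ultimately have "reach n x (put n q ys) (put n (Suc q) ys)"
    unfolding reach_def by blast
  then show ?case
    using step reach_trans by (metis Suc_lessD)
qed

lemma sum_list_last_less:
  assumes "length zs \<ge> 2" "\<And>z. z \<in> set zs \<Longrightarrow> f z > (0 :: nat)"
  shows "f (last zs) < (\<Sum>z\<leftarrow>zs. f z)"
proof -
  have zs: "zs = butlast zs @ [last zs]" "butlast zs \<noteq> []"
    using assms(1) by (cases zs rule: rev_cases; force)+
  then have "f (hd (butlast zs)) > 0"
    by (intro assms(2)) (metis hd_in_set in_set_butlastD)
  moreover have "f (hd (butlast zs)) \<le> (\<Sum>z\<leftarrow>butlast zs. f z)"
    using zs(2) by (intro member_le_sum_list) simp_all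
  moreover have "(\<Sum>z\<leftarrow>zs. f z) = (\<Sum>z\<leftarrow>butlast zs. f z) + f (last zs)"
    by (subst zs(1)) simp
  ultimately show ?thesis
    by linarith
qed

text \<open>The measure counts the leaves outside the last argument. An operation among the earlier
  arguments is slid to the last slot, where it absorbs the old last argument and
  \<open>n - 1\<close> terms before it. The number of all leaves is unchanged, so the measure
  drops.\<close>

lemma reach_spine:
  fixes x :: "nat \<Rightarrow> 'v"
  assumes "n \<ge> 2" "inj_on x {1..2 * n - 1}" "Op ts \<in> terms n"
  shows "\<exists>vs r. length vs = n - 1 \<and> reach n x (Op ts) (Op (map Var vs @ [r]))"
  using assms(3)
proof (induction "length (lv (Op ts)) - length (lv (last ts))" arbitrary: ts rule: less_induct)
  case less
  have ts: "length ts = n" "set ts \<subseteq> terms n"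
    using less.prems by (auto elim: terms.cases)
  have pos: "length (lv t) > 0" if "t \<in> terms n" for t :: "'v trm"
    using lv_nonempty[OF that] assms(1) by simp
  have last_less: "length (lv (last zs)) < length (lv (Op zs))" if "length zs = n"
      "set zs \<subseteq> terms n" for zs :: "'v trm list"
    unfolding length_lv_Op using that assms(1) pos
    by (intro sum_list_last_less[of zs "\<lambda>t. length (lv t)"]) auto
  show ?case
  proof (cases "\<forall>t\<in>set (butlast ts). \<exists>v. t = Var v")
    case True
    then obtain vs where vs: "butlast ts = map Var vs"
      unfolding ex_map_conv[of "butlast ts" Var, symmetric] by (elim exE)
    have "ts \<noteq> []"
      using ts(1) assms(1) by auto
    then have "ts = map Var vs @ [last ts]"
      unfolding vs[symmetric] by simp
    moreover have "length vs = n - 1"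
      using arg_cong[OF vs, of length] ts(1) by simp
    ultimately show ?thesis
      using reach_refl[OF less.prems, of x] by (intro exI[of _ vs] exI[of _ "last ts"]) simp
  next
    case False
    then obtain t where t: "t \<in> set (butlast ts)" "\<forall>v. t \<noteq> Var v"
      by blast
    then obtain p where p: "p < n - 1" "ts ! p = t"
      using ts(1) by (auto simp: in_set_conv_nth nth_butlast)
    obtain ss where ss: "ts ! p = Op ss"
      using t(2) p(2) by (cases t) auto
    have "Op ss \<in> terms n"
      using ts p ss by (metis in_set_butlastD subsetD t(1))
    then have ss': "length ss = n" "set ss \<subseteq> terms n"
      by (auto elim: terms.cases)
    define ys where "ys = take p ts @ ss @ drop (Suc p) ts"
    have ys: "Op ts = put n p ys" "length ys = 2 * n - 1"
      using Op_nth_eq_put[OF ts(1) ss'(1) _ ss] p(1) unfolding ys_def by simp_all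
    have ys': "set ys \<subseteq> terms n"
      using ts(2) ss'(2) set_take_subset[of p ts] set_drop_subset[of "Suc p" ts] unfolding ys_def
        by auto
    \<comment> \<open>These become the arguments of the inner operation once it stands in the last
      slot.\<close>
    define zs where "zs = drop (n - 1) ys"
    have zs: "length zs = n" "set zs \<subseteq> terms n"
      using ys ys' assms(1) set_drop_subset[of "n - 1" ys] unfolding zs_def by auto
    \<comment> \<open>As \<open>p < n - 1\<close>, the argument that was opened up is not the last
      one.\<close>
    have "last zs = last ts"
      using p(1) ts(1) ys(2) unfolding zs_def ys_def by (simp add: last_drop)
    then have less_zs: "length (lv (last ts)) < length (lv (Op zs))"
      using last_less[OF zs] by simp
    have put: "put n (n - 1) ys = Op (take (n - 1) ys @ [Op zs])"
      using ys(2) assms(1) zs(1) unfolding put_def zs_def by simp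
    have r: "reach n x (Op ts) (Op (take (n - 1) ys @ [Op zs]))"
      using reach_put[OF assms(2) _ _ ys(2) ys', of p "n - 1"] p(1) unfolding ys(1) put by simp
    then have len: "length (lv (Op ts)) = length (lv (Op (take (n - 1) ys @ [Op zs])))"
      using reach_vlist map_eq_imp_length_eq by blast
    have tm: "Op (take (n - 1) ys @ [Op zs]) \<in> terms n"
      using reach_in_terms[OF r] by blast
    have "length (lv (Op (take (n - 1) ys @ [Op zs]))) - length (lv (last (take (n - 1) ys @ [Op zs])))
        < length (lv (Op ts)) - length (lv (last ts))"
      using less_zs len last_less[OF ts] by simp
    from less.hyps[OF this tm] obtain vs r' where
      "length vs = n - 1" "reach n x (Op (take (n - 1) ys @ [Op zs])) (Op (map Var vs @ [r']))"
      by (elim exE conjE)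
    then show ?thesis
      using reach_trans[OF r] by (intro exI[of _ vs] exI[of _ r']) simp
  qed
qed

inductive right_comb :: "nat \<Rightarrow> 'v trm \<Rightarrow> bool" for n where
  Var: "right_comb n (Var v)"
| Op: "length vs = n - 1 \<Longrightarrow> right_comb n r \<Longrightarrow> right_comb n (Op (map Var vs @ [r]))"

lemma vlist_spine: "vlist (Op (map Var vs @ [r])) = vs @ vlist r"
  by (simp add: vlist_Op comp_def)

text \<open>Splitting off \<open>n - 1\<close> variables leaves a tail with fewer leaves, which is
  combed by induction and put back by \<open>reach_last\<close>.\<close>

lemma reach_right_comb:
  assumes "n \<ge> 2" "inj_on x {1..2 * n - 1}" "u \<in> terms n"
  shows "\<exists>r. right_comb n r \<and> reach n x u r"
  using assms(3)
proof (induction "length (lv u)" arbitrary: u rule: less_induct)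
  case less
  show ?case
  proof (cases u)
    case (Var v)
    show ?thesis
      by (rule exI[of _ u],
        rule conjI[OF _ reach_refl[OF less.prems]]) (simp add: Var right_comb.Var)
  next
    case (Op ts)
    from reach_spine[OF assms(1,2) less.prems[unfolded Op]]
    obtain vs r where vs: "length vs = n - 1" "reach n x u (Op (map Var vs @ [r]))"
      unfolding Op by (elim exE conjE)
    have "Op (map Var vs @ [r]) \<in> terms n"
      using reach_in_terms[OF vs(2)] by blast
    then have r: "r \<in> terms n"
      by (auto elim: terms.cases)
    have "vlist u = vs @ vlist r"
      using reach_vlist[OF vs(2)] vlist_spine by metis
    then have "length (lv u) = (n - 1) + length (lv r)"
      using vs(1) by (metis length_append length_map)
    then have "length (lv r) < length (lv u)"
      using assms(1) by simp
    from less.hyps[OF this r] obtain r' where r': "right_comb n r'" "reach n x r r'"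
      by (elim exE conjE)
    have "set (map Var vs) \<subseteq> terms n"
      by (auto intro: terms.Var)
    then have "reach n x (Op (map Var vs @ [r])) (Op (map Var vs @ [r']))"
      using reach_last[OF r'(2)] vs(1) assms(1) by simp
    from reach_trans[OF vs(2) this] right_comb.Op[OF vs(1) r'(1)] show ?thesis
      by (intro exI[of _ "Op (map Var vs @ [r'])"] conjI)
  qed
qed

lemma right_comb_nonempty: "right_comb n r \<Longrightarrow> lv r \<noteq> []"
proof (induction rule: right_comb.induct)
  case (Op vs r)
  then have "vlist (Op (map Var vs @ [r])) \<noteq> []"
    unfolding vlist_spine by simp
  then show ?case by simp
qed simp

text \<open>The label sequence is cut from the left into blocks of length \<open>n - 1\<close>. A
  comb with an operation has at least two labels, which separates it from a variable.\<close>

lemma right_comb_unique: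
  assumes "n \<ge> 2"
  shows "right_comb n r \<Longrightarrow> right_comb n r' \<Longrightarrow> vlist r = vlist r' \<Longrightarrow> r = r'"
proof (induction arbitrary: r' rule: right_comb.induct)
  case (Var v)
  show ?case
    using Var(1)
  proof cases
    case (Op vs s)
    have "length (vs @ vlist s) = 1"
      using Var(2) unfolding Op vlist_spine by (metis length_Cons list.size(3) lv.simps(1)
        list.simps(9) list.map(1) One_nat_def)
    moreover have "length (vlist s) > 0"
      using right_comb_nonempty[OF Op(3)] by simp
    ultimately show ?thesis
      using Op(2) assms unfolding length_append by linarith
  qed (use Var(2) in simp)
next
  case (Op vs r)
  show ?case
    using Op.prems(1)
  proof cases
    case (Var v)
    have "length (vs @ vlist r) = 1"
      using Op.prems(2) unfolding Var vlist_spine by simp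
    moreover have "length (vlist r) > 0"
      using right_comb_nonempty[OF Op.hyps(2)] by simp
    ultimately show ?thesis
      using Op.hyps(1) assms unfolding length_append by linarith
  next
    case (Op vs' s)
    have "vs @ vlist r = vs' @ vlist s"
      using Op.prems(2) unfolding Op vlist_spine .
    then have "vs = vs'" "vlist r = vlist s"
      using Op.hyps(1) Op(2) by simp_all
    then show ?thesis
      using Op.IH Op by blast
  qed
qed

lemma reachI:
  assumes "n \<ge> 2" "inj_on x {1..2 * n - 1}" "u \<in> terms n" "v \<in> terms n" "vlist u = vlist v"
  shows "reach n x u v"
proof -
  obtain r where r: "right_comb n r" "reach n x u r"
    using reach_right_comb[OF assms(1-3)] by (elim exE conjE)
  obtain r' where r': "right_comb n r'" "reach n x v r'"
    using reach_right_comb[OF assms(1,2,4)] by (elim exE conjE)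
  have "r = r'"
    using right_comb_unique[OF assms(1) r(1) r'(1)] reach_vlist[OF r(2)] reach_vlist[OF r'(2)]
      assms(5) by simp
  then show ?thesis
    using reach_trans[OF r(2)] reach_sym[OF r'(2)] by simp
qed

section \<open>Universal groups\<close>

lemma (in monoid) idem_cong_equiv: "equiv (carrier G) (idem_cong G)"
proof (rule equivI)
  have "a \<in> carrier G \<and> b \<in> carrier G" if "(a, b) \<in> idem_cong G" for a b
    using that by (induction rule: idem_cong.induct) auto
  then show "idem_cong G \<subseteq> carrier G \<times> carrier G"
    by auto
  show "refl_on (carrier G) (idem_cong G)"
    by (rule refl_onI) (rule idem_cong.refl)
  show "sym (idem_cong G)"
    by (rule symI) (rule idem_cong.sym)
  show "trans (idem_cong G)"
    by (rule transI) (rule idem_cong.trans)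
qed

lemma (in monoid) universal_group_mult:
  assumes "a \<in> carrier G" "b \<in> carrier G"
  shows "(idem_cong G `` {a}) \<otimes>\<^bsub>universal_group G\<^esub> (idem_cong G `` {b}) = idem_cong G `` {a \<otimes> b}"
proof -
  have "congruent2 (idem_cong G) (idem_cong G) (\<lambda>a b. idem_cong G `` {a \<otimes> b})"
    by (rule congruent2I') (intro equiv_class_eq[OF idem_cong_equiv] idem_cong.mult)
  then show ?thesis
    using UN_equiv_class2[OF idem_cong_equiv idem_cong_equiv _ assms]
      by (simp add: universal_group_def)
qed

text \<open>The map \<open>h\<close> factors through the quotient, as in the first isomorphism
  theorem, with \<open>inv\<close> supplying left inverses modulo the congruence. That
  \<open>H\<close> is a group is a conclusion, transported from the quotient.\<close>

lemma (in monoid) universal_group_iso: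
  fixes H (structure)
  assumes hom: "\<And>a b. a \<in> carrier G \<Longrightarrow> b \<in> carrier G \<Longrightarrow> h (a \<otimes>\<^bsub>G\<^esub> b) = h a \<otimes>\<^bsub>H\<^esub> h b"
    and img: "h ` carrier G = carrier H"
    and one: "h \<one>\<^bsub>G\<^esub> = \<one>\<^bsub>H\<^esub>"
    and ker: "\<And>a b. a \<in> carrier G \<Longrightarrow> b \<in> carrier G \<Longrightarrow> (a, b) \<in> idem_cong G \<longleftrightarrow> h a = h b"
    and inv: "\<And>a. a \<in> carrier G \<Longrightarrow> \<exists>b\<in>carrier G. (b \<otimes>\<^bsub>G\<^esub> a, \<one>\<^bsub>G\<^esub>) \<in> idem_cong G"
  shows "group (universal_group G)" "group H" "universal_group G \<cong> H"
proof -
  let ?R = "idem_cong G" and ?U = "universal_group G"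
  have car: "carrier ?U = carrier G // ?R" and oneU: "\<one>\<^bsub>?U\<^esub> = ?R `` {\<one>\<^bsub>G\<^esub>}"
    by (simp_all add: universal_group_def)
  have rep: "\<exists>a\<in>carrier G. X = ?R `` {a}" if "X \<in> carrier ?U" for X
    using that unfolding car by (auto elim: quotientE)
  have cls: "?R `` {a} \<in> carrier ?U" if "a \<in> carrier G" for a
    using that unfolding car by (rule quotientI)
  note eq = equiv_class_eq[OF idem_cong_equiv]
  show U: "group ?U"
  proof (rule groupI)
    show "\<one>\<^bsub>?U\<^esub> \<in> carrier ?U"
      unfolding oneU by (simp add: cls)
    fix X assume "X \<in> carrier ?U"
    then obtain a where a: "a \<in> carrier G" "X = ?R `` {a}"
      using rep by auto
    show "\<one>\<^bsub>?U\<^esub> \<otimes>\<^bsub>?U\<^esub> X = X"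
      using a by (simp add: oneU universal_group_mult)
    obtain b where b: "b \<in> carrier G" "(b \<otimes>\<^bsub>G\<^esub> a, \<one>\<^bsub>G\<^esub>) \<in> ?R"
      using inv[OF a(1)] by auto
    have "(?R `` {b}) \<otimes>\<^bsub>?U\<^esub> X = \<one>\<^bsub>?U\<^esub>"
      unfolding a(2) universal_group_mult[OF b(1) a(1)] oneU by (rule eq[OF b(2)])
    then show "\<exists>Y\<in>carrier ?U. Y \<otimes>\<^bsub>?U\<^esub> X = \<one>\<^bsub>?U\<^esub>"
      using cls[OF b(1)] by (intro bexI)
    fix Y assume "Y \<in> carrier ?U"
    then obtain b where b: "b \<in> carrier G" "Y = ?R `` {b}"
      using rep by auto
    show "X \<otimes>\<^bsub>?U\<^esub> Y \<in> carrier ?U"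
      using a b by (simp add: universal_group_mult cls)
    fix Z assume "Z \<in> carrier ?U"
    then obtain c where c: "c \<in> carrier G" "Z = ?R `` {c}"
      using rep by auto
    show "X \<otimes>\<^bsub>?U\<^esub> Y \<otimes>\<^bsub>?U\<^esub> Z = X \<otimes>\<^bsub>?U\<^esub> (Y \<otimes>\<^bsub>?U\<^esub> Z)"
      using a b c by (simp add: universal_group_mult m_assoc)
  qed
  \<comment> \<open>By \<open>ker\<close> the image of a class is a singleton.\<close>
  define k where "k X = the_elem (h ` X)" for X
  have k: "k (?R `` {a}) = h a" if a: "a \<in> carrier G" for a
  proof -
    have "h ` (?R `` {a}) \<subseteq> {h a}"
    proof (rule image_subsetI)
      fix b assume "b \<in> ?R `` {a}"

      then have "(a, b) \<in> ?R"
        by simp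
      moreover from this have "b \<in> carrier G"
        using equiv_type[OF idem_cong_equiv] by auto
      ultimately show "h b \<in> {h a}"
        using ker[OF a, of b] by simp
    qed
    moreover have "h a \<in> h ` (?R `` {a})"
      by (rule imageI) (simp add: idem_cong.refl[OF a])
    ultimately have "h ` (?R `` {a}) = {h a}"
      by blast
    then show ?thesis
      by (simp add: k_def)
  qed
  have k_img: "k ` carrier ?U = carrier H"
  proof (intro subset_antisym subsetI)
    fix y assume "y \<in> k ` carrier ?U"
    then obtain X where "X \<in> carrier ?U" "y = k X"
      by (elim imageE)
    moreover from this rep obtain a where "a \<in> carrier G" "X = ?R `` {a}"
      by meson
    ultimately show "y \<in> carrier H"
      using k img by auto
  next
    fix y assume "y \<in> carrier H"
    then obtain a where "a \<in> carrier G" "y = h a"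
      unfolding img[symmetric] by (elim imageE)
    then show "y \<in> k ` carrier ?U"
      using k cls by (intro image_eqI[of _ _ "?R `` {a}"]) simp_all
  qed
  have k_hom: "k \<in> hom ?U H"
  proof (rule homI)
    fix X Y assume XY: "X \<in> carrier ?U" "Y \<in> carrier ?U"
    show "k X \<in> carrier H"
      using XY k_img by auto
    obtain a b where "a \<in> carrier G" "X = ?R `` {a}" "b \<in> carrier G" "Y = ?R `` {b}"
      using rep XY by meson
    then show "k (X \<otimes>\<^bsub>?U\<^esub> Y) = k X \<otimes>\<^bsub>H\<^esub> k Y"
      by (simp add: universal_group_mult k hom)
  qed
  have "inj_on k (carrier ?U)"
  proof (rule inj_onI)
    fix X Y assume XY: "X \<in> carrier ?U" "Y \<in> carrier ?U" "k X = k Y"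
    obtain a b where "a \<in> carrier G" "X = ?R `` {a}" "b \<in> carrier G" "Y = ?R `` {b}"
      using rep XY(1,2) by meson
    then show "X = Y"
      using XY(3) ker[of a b] eq[of a b] by (simp add: k)
  qed
  then have "k \<in> iso ?U H"
    using k_hom k_img by (simp add: iso_iff)
  then show "?U \<cong> H"
    by (rule is_isoI)
  \<comment> \<open>Membership in \<open>hom\<close> concerns products only, so the unit is compared
    separately before \<open>H\<close> is recognised as the image group.\<close>
  have "k \<one>\<^bsub>?U\<^esub> = \<one>\<^bsub>H\<^esub>"
    using one by (simp add: oneU k)
  then show "group H"
    using group.hom_imp_img_group[OF U k_hom] k_img by simp
qed

section \<open>The isomorphism\<close>

lemma diagram_equiv_class:
  assumes "n \<ge> 2" "d \<in> diagrams n" "dacts n F d"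
  shows "diagram_equiv n `` {d} = {e \<in> diagrams n. dacts n F e}"
  using diagram_equiv_iff[OF assms(1,3)] assms(2) by (auto simp: Image_iff)

text \<open>The homomorphism to the group of tree symbols. Taking all diagrams with the right action
  avoids choosing a pair from the graph of \<open>f\<close>.\<close>

definition tree_symbol :: "nat \<Rightarrow> ('v trm \<times> 'v trm) set \<Rightarrow> diagram set" where
  "tree_symbol n f = {d \<in> diagrams n. dacts n (act n f) d}"

lemma tree_symbol_eq_class:
  assumes "n \<ge> 2" "f \<in> struct_carrier n x" "(u, v) \<in> f"
  shows "tree_symbol n f = diagram_equiv n `` {diag u v}"
  using diagram_equiv_class[OF assms(1) diag_acts[OF assms(2,3)]] by (simp add: tree_symbol_def)

lemma diag_in_tree_symbol:
  assumes "f \<in> struct_carrier n x" "(u, v) \<in> f"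
  shows "diag u v \<in> tree_symbol n f"
  using diag_acts[OF assms] by (simp add: tree_symbol_def)

lemma carrier_F_group:
  "carrier (F_group n) = {A. A \<in> diagrams n // diagram_equiv n \<and> (\<exists>d\<in>A. order_preserving d)}"
  by (simp add: F_group_def G_group_def)

lemma tree_symbol_image:
  fixes x :: "nat \<Rightarrow> 'v"
  assumes "n \<ge> 2" "inj_on x {1..2 * n - 1}"
  shows "tree_symbol n ` struct_carrier n x = carrier (F_group n)"
proof (intro subset_antisym subsetI)
  fix A assume "A \<in> tree_symbol n ` struct_carrier n x"
  then obtain f where f: "f \<in> struct_carrier n x" "A = tree_symbol n f"
    by (elim imageE)
  obtain u v where uv: "(u, v) \<in> f"
    using struct_carrier_nonempty[OF assms(2) f(1)] .
  have "A \<in> diagrams n // diagram_equiv n"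
    unfolding f(2) tree_symbol_eq_class[OF assms(1) f(1) uv]
    using diag_acts(1)[OF f(1) uv] by (rule quotientI)
  moreover have "length (lv u) = length (lv v)"
    using acts_vlist[OF sactD[OF act(2)[OF f(1)] uv]] by (rule map_eq_imp_length_eq)
  then have "order_preserving (diag u v)"
    by (rule order_preserving_diag)
  moreover have "diag u v \<in> A"
    unfolding f(2) using f(1) uv by (rule diag_in_tree_symbol)
  ultimately show "A \<in> carrier (F_group n)"
    unfolding carrier_F_group by (intro CollectI conjI bexI)
next
  fix A assume "A \<in> carrier (F_group n)"
  then obtain d where A: "A \<in> diagrams n // diagram_equiv n" and d: "d \<in> A" "order_preserving d"
    unfolding carrier_F_group by (elim CollectE conjE bexE)
  obtain T\<^sub>1 T\<^sub>2 \<sigma> where T: "d = (T\<^sub>1, T\<^sub>2, \<sigma>)"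
    by (cases d)
  from A obtain d' where d': "d' \<in> diagrams n" "A = diagram_equiv n `` {d'}"
    by (rule quotientE)
  obtain F where F: "dacts n F d'"
    using dacts_exists[OF d'(1)] by (elim exE)
  have AF: "A = {e \<in> diagrams n. dacts n F e}"
    using diagram_equiv_class[OF assms(1) d'(1) F] d'(2) by simp
  then have dF: "d \<in> diagrams n" "dacts n F d"
    using d(1) by simp_all
  \<comment> \<open>One common label at all leaves makes the label sequence depend only on the
    number of leaves, which is the same for both trees.\<close>
  define u where "u = fill (x 0) T\<^sub>1"
  define v where "v = fill (x 0) T\<^sub>2"
  have sh: "shape u = T\<^sub>1" "shape v = T\<^sub>2"
    by (simp_all add: u_def v_def shape_fill)
  have tm: "u \<in> terms n" "v \<in> terms n"
    using dF(1) by (simp_all add: T diagrams_def u_def v_def fill_in_terms)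
  have "diag u v = (shape u, shape v, \<sigma>)"
    using dF(1) d(2) by (intro diag_eq) (simp_all add: T sh)
  then have diag: "diag u v = d"
    by (simp add: T sh)
  have "length (lv u) = card (leaves (shape u))" for u :: "'v trm"
    using distinct_card[OF distinct_addrs[of u]] set_addrs[of u] by simp
  moreover have "bij_betw \<sigma> (leaves T\<^sub>1) (leaves T\<^sub>2)"
    using dF(1) by (simp add: T diagrams_def)
  then have "card (leaves T\<^sub>1) = card (leaves T\<^sub>2)"
    by (rule bij_betw_same_card)
  ultimately have "length (vlist u) = length (vlist v)"
    by (simp add: sh)
  moreover have "vlist (fill (x 0) T) = replicate (length (vlist (fill (x 0) T))) (x 0)" for T
  proof (rule replicate_eqI)
    fix y assume "y \<in> set (vlist (fill (x 0) T))"
    then have "y \<in> {x 0}"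
      using vlist_fill by (rule subsetD[rotated])
    then show "y = x 0"
      by simp
  qed simp
  ultimately have "vlist u = vlist v"
    unfolding u_def v_def by metis
  then have "reach n x u v"
    by (rule reachI[OF assms tm])
  then obtain f where f: "f \<in> struct_carrier n x" "(u, v) \<in> f"
    unfolding reach_def by (elim bexE)
  have "A = diagram_equiv n `` {d}"
    using diagram_equiv_class[OF assms(1) dF] AF by simp
  then have "A = tree_symbol n f"
    using tree_symbol_eq_class[OF assms(1) f] diag by simp
  then show "A \<in> tree_symbol n ` struct_carrier n x"
    using f(1) by (rule image_eqI)
qed

lemma tree_symbol_eq_iff:
  assumes "n \<ge> 2" "inj_on x {1..2 * n - 1}" "f \<in> struct_carrier n x" "g \<in> struct_carrier n x"
  shows "tree_symbol n f = tree_symbol n g \<longleftrightarrow> act n f = act n g"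
proof
  assume "tree_symbol n f = tree_symbol n g"
  moreover obtain u v where uv: "(u, v) \<in> f"
    using struct_carrier_nonempty[OF assms(2,3)] .
  ultimately have "dacts n (act n g) (diag u v)"
    using diag_in_tree_symbol[OF assms(3) uv] by (simp add: tree_symbol_def)
  then have "act n f w = act n g w" if "w \<in> streams {1..n}" for w
    using dacts_unique[OF diag_acts[OF assms(3) uv] _ that] by simp
  then show "act n f = act n g"
    using act(1)[OF assms(3)] act(1)[OF assms(4)] by (intro extensionalityI)
qed (simp add: tree_symbol_def)

section \<open>Products of tree symbols\<close>

lemma compose_diagram:
  assumes "(T\<^sub>1, T, \<sigma>) \<in> diagrams n" "dacts n F (T\<^sub>1, T, \<sigma>)" "(T, T\<^sub>2, \<sigma>') \<in> diagrams n"
      "dacts n G (T, T\<^sub>2, \<sigma>')"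
  shows "(T\<^sub>1, T\<^sub>2, compose (leaves T\<^sub>1) \<sigma>' \<sigma>) \<in> diagrams n"
    "dacts n (\<lambda>w. G (F w)) (T\<^sub>1, T\<^sub>2, compose (leaves T\<^sub>1) \<sigma>' \<sigma>)"
proof -
  have bij: "bij_betw \<sigma> (leaves T\<^sub>1) (leaves T)" "bij_betw \<sigma>' (leaves T) (leaves T\<^sub>2)"
    using assms(1,3) by (simp_all add: diagrams_def)
  then have "bij_betw (compose (leaves T\<^sub>1) \<sigma>' \<sigma>) (leaves T\<^sub>1) (leaves T\<^sub>2)"
    by (rule bij_betw_compose)
  then show "(T\<^sub>1, T\<^sub>2, compose (leaves T\<^sub>1) \<sigma>' \<sigma>) \<in> diagrams n"
    using assms(1,3) by (simp add: diagrams_def compose_extensional)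
  have "G (F (l @- w)) = compose (leaves T\<^sub>1) \<sigma>' \<sigma> l @- w" if "l \<in> leaves T\<^sub>1" "w \<in> streams {1..n}"
      for l w
    using dactsD[OF assms(2) that] dactsD[OF assms(4) bij_betw_apply[OF bij(1) that(1)] that(2)]
      that(1)
    by (simp add: compose_eq)
  then show "dacts n (\<lambda>w. G (F w)) (T\<^sub>1, T\<^sub>2, compose (leaves T\<^sub>1) \<sigma>' \<sigma>)"
    by (simp add: dacts_def)
qed

text \<open>The union defining the product collapses because \<open>?S\<close> is a singleton: all
  its classes carry the composite action, and it has a member.\<close>

lemma tree_symbol_mult:
  assumes "n \<ge> 2" "inj_on x {1..2 * n - 1}" "f \<in> struct_carrier n x" "g \<in> struct_carrier n x"
  shows "tree_symbol n (f O g) = tree_symbol n f \<otimes>\<^bsub>F_group n\<^esub> tree_symbol n g"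
proof -
  let ?S = "{diagram_equiv n `` {(T\<^sub>1, T\<^sub>2, compose (leaves T\<^sub>1) \<sigma>' \<sigma>)} | T\<^sub>1 T T\<^sub>2 \<sigma> \<sigma>'.
    (T\<^sub>1, T, \<sigma>) \<in> tree_symbol n f \<and> (T, T\<^sub>2, \<sigma>') \<in> tree_symbol n g}"
  have fg: "f O g \<in> struct_carrier n x"
    using assms(3,4) by (rule struct_carrier.comp)
  have cls: "diagram_equiv n `` {(T\<^sub>1, T\<^sub>2, compose (leaves T\<^sub>1) \<sigma>' \<sigma>)} = tree_symbol n (f O g)"
    if "(T\<^sub>1, T, \<sigma>) \<in> tree_symbol n f" "(T, T\<^sub>2, \<sigma>') \<in> tree_symbol n g" for T\<^sub>1 T T\<^sub>2 \<sigma> \<sigma>'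
  proof -
    let ?d = "(T\<^sub>1, T\<^sub>2, compose (leaves T\<^sub>1) \<sigma>' \<sigma>)"
    have fg: "(T\<^sub>1, T, \<sigma>) \<in> diagrams n" "dacts n (act n f) (T\<^sub>1, T, \<sigma>)"
      "(T, T\<^sub>2, \<sigma>') \<in> diagrams n" "dacts n (act n g) (T, T\<^sub>2, \<sigma>')"
      using that by (simp_all add: tree_symbol_def)
    note d = compose_diagram[OF fg]
    have "dacts n (act n (f O g)) ?d"
      by (rule dacts_cong[THEN iffD2, OF act_relcomp[OF assms(2-4)] d])
    then show ?thesis
      using diagram_equiv_class[OF assms(1) d(1)] by (simp add: tree_symbol_def)
  qed
  \<comment> \<open>A pair of the composite factors through some \<open>v\<close>, which yields two
    diagrams with the matching middle tree \<open>shape v\<close>.\<close>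
  obtain u w where "(u, w) \<in> f O g"
    using struct_carrier_nonempty[OF assms(2) fg] .
  then obtain v where v: "(u, v) \<in> f" "(v, w) \<in> g"
    by (rule relcompEpair)
  obtain \<sigma> \<sigma>' where \<sigma>: "diag u v = (shape u, shape v, \<sigma>)" "diag v w = (shape v, shape w, \<sigma>')"
    unfolding diag_def by simp
  note dgm = diag_in_tree_symbol[OF assms(3) v(1), unfolded \<sigma>] diag_in_tree_symbol[OF assms(4) v(2),
      unfolded \<sigma>]
  have "tree_symbol n (f O g) \<in> ?S"
    by (intro CollectI exI[of _ "shape u"] exI[of _ "shape v"] exI[of _ "shape w"] exI[of _ \<sigma>]
      exI[of _ \<sigma>']
        conjI cls[OF dgm, symmetric] dgm)
  then have "{tree_symbol n (f O g)} \<subseteq> ?S"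
    by (simp only: insert_subset empty_subsetI)
  moreover have "?S \<subseteq> {tree_symbol n (f O g)}"
  proof (rule subsetI)
    fix X assume "X \<in> ?S"
    then show "X \<in> {tree_symbol n (f O g)}"
      by (elim CollectE exE conjE) (simp only: cls singleton_iff)
  qed
  ultimately have "?S = {tree_symbol n (f O g)}"
    by (rule subset_antisym[rotated])
  then have "\<Union>?S = tree_symbol n (f O g)"
    by (simp only: cSup_singleton)
  then show ?thesis
    by (simp add: F_group_def G_group_def)
qed

lemma tree_symbol_one:
  fixes x :: "nat \<Rightarrow> 'v"
  assumes "n \<ge> 2" "inj_on x {1..2 * n - 1}"
  shows "tree_symbol n (Id_on (terms n :: 'v trm set)) = \<one>\<^bsub>F_group n\<^esub>"
proof -
  let ?d = "(Leaf, Leaf, restrict id (leaves Leaf))"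
  have "?d \<in> diagrams n"
    by (auto simp: diagrams_def bij_betw_def intro: trees.Leaf)
  moreover have "dacts n (act n (Id_on (terms n :: 'v trm set))) ?d"
    using act_Id_on[OF assms(2)] by (simp add: dacts_def)
  ultimately have "diagram_equiv n `` {?d} = tree_symbol n (Id_on (terms n :: 'v trm set))"
    using diagram_equiv_class[OF assms(1)] by (simp add: tree_symbol_def)
  then show ?thesis
    by (simp add: F_group_def G_group_def)
qed

theorem theorem4p9:
  fixes n :: nat and x :: "nat \<Rightarrow> 'v"
  assumes "n \<ge> 2"
    and "inj_on x {1..2 * n - 1}"
  shows "group (struct_group n x) \<and> group (F_group n) \<and> struct_group n x \<cong> F_group n"
proof -
  interpret monoid "struct_monoid n x"
    by (rule monoid_struct_monoid)
  have inv: "\<exists>g\<in>struct_carrier n x. (g O f, Id_on (terms n)) \<in> idem_cong (struct_monoid n x)"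
    if f: "f \<in> struct_carrier n x" for f
  proof (rule bexI)
    show g: "f\<inverse> \<in> struct_carrier n x"
      using f by (rule struct_carrier_converse)
    have e: "f\<inverse> O f \<in> struct_carrier n x"
      using g f by (rule struct_carrier.comp)
    \<comment> \<open>Applied to the converse of \<open>f\<close>,
      \<open>act_relcomp_converse\<close> gives this product the trivial action.\<close>
    have "(f\<inverse> O f) O (f\<inverse> O f) = f\<inverse> O f"
      using act_relcomp_converse[OF assms(2) g] by (intro act_identity_idempotent[OF assms(1) e])
        simp
    then show "(f\<inverse> O f, Id_on (terms n)) \<in> idem_cong (struct_monoid n x)"
      using idem_cong.idem[of "f\<inverse> O f" "struct_monoid n x"] e by simp
  qed
  have "group (universal_group (struct_monoid n x))" "group (F_group n)"
    "universal_group (struct_monoid n x) \<cong> F_group n"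
    using universal_group_iso[of "tree_symbol n" "F_group n"] inv tree_symbol_mult[OF assms]
      tree_symbol_image[OF assms] tree_symbol_one[OF assms] idem_cong_struct_iff[OF assms]
      tree_symbol_eq_iff[OF assms] by simp_all
  then show ?thesis
    by (simp add: struct_group_def)
qed

end
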